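(* Let $\alpha$ be a real number with $0\le\alpha<1/2$. Then the equality $$\int_{-\infty}^{\infty}\frac{\ln\bigl|\zeta(1/2+\alpha+it)\,(-1/2+\alpha+it)\bigr|}{(1/2-\alpha)^2+t^2}\,dt=0$$ holds if and only if the Riemann zeta function $\zeta$ has no zeros $\sigma+it$ with $\sigma>1/2+\alpha$. In particular, for $\alpha=0$ this equality is equivalent to the Riemann hypothesis.
   Context: $\zeta$ denotes the Riemann zeta function. The Riemann hypothesis is the statement that $\zeta$ has no zeros with real part $>1/2$ (all non-trivial zeros lie on the line $\operatorname{Re} s=1/2$). *)

theory Defs
  imports "HOL-Complex_Analysis.Complex_Analysis"
begin

text \<open>The Riemann zeta function on \<open>\<complex> - {1}\<close>: the (unique) holomorphic function on
  \<open>\<complex> - {1}\<close> agreeing with the Dirichlet series \<open>\<Sum> n\<ge>1. n^(-s)\<close> for \<open>Re s > 1\<close>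
  (analytic continuation). Its value at the pole \<open>s = 1\<close> is unspecified.\<close>
definition riemann_zeta :: "complex \<Rightarrow> complex" where
  "riemann_zeta = (SOME f. f holomorphic_on (- {1}) \<and>
      (\<forall>s. Re s > 1 \<longrightarrow> f s = (\<Sum>n. 1 / (of_nat (Suc n)) powr s)))"

end

theory Submission
  imports Defs "HOL-Real_Asymp.Real_Asymp"
begin

text \<open>
  Put \<open>g(s) = (s - 1) \<zeta>(s)\<close>, so that \<open>g(1) = 1\<close>, and \<open>\<sigma> = 1/2 + \<alpha>\<close>. The weight of the integral is, up
  to a constant, the Poisson kernel of the half-plane \<open>Re s > \<sigma>\<close> at the point \<open>1\<close>. Since \<open>g\<close> grows
  polynomially, Jensen's inequality on the half-plane (transported to discs of radius \<open>r < 1\<close>, then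
  Fatou's lemma as \<open>r \<rightarrow> 1\<close>) shows that the integral is at least a positive multiple of \<open>ln |g(1)| = 0\<close>.
  If \<open>g\<close> has a zero to the right of the line, the same inequality for \<open>g\<close> divided by the Blaschke factor
  of that zero gives a positive lower bound.

  If \<open>g\<close> has no such zero, the Borel--Caratheodory inequality shows that \<open>1 / g\<close> also grows
  polynomially on \<open>Re s \<ge> \<sigma>'\<close> for every \<open>\<sigma>' > \<sigma>\<close>; Jensen's inequality for \<open>g\<close> and \<open>1 / g\<close> then shows
  that the integral over the line \<open>Re s = \<sigma>'\<close> vanishes. Finally \<open>\<sigma>' \<rightarrow> \<sigma>\<close>, the passage to the limit
  being dominated on compact sets and uniformly small near infinity.
\<close>

section \<open>Analytic continuation and growth of the zeta function\<close>

text \<open>Zeros on the line \<open>Re s = \<sigma>\<close> itself cannot be excluded, and they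
  shape the argument. They make \<open>ln |g|\<close> unbounded below, so growth estimates bound the
  integrand from above only. Jensen's inequality survives this, because Fatou's lemma asks just for
  an upper majorant, but it gives one direction. The other direction is Jensen's inequality for
  \<open>1 / g\<close>, which may have poles on the line; hence it is used strictly to the right,
  and the line is moved afterwards. Moving the line requires control from below. On a compact
  segment, \<open>|g|\<close> is compared with a real polynomial in \<open>t\<close> that has the
  same heights of zeros. Near infinity, the upper bound on \<open>ln |g|\<close> and a lower bound
  for one weighted integral of it together control the integral of its absolute value. The argument
  stays in \<open>Re s \<ge> 1/2\<close>, but \<open>riemann_zeta\<close> is a choice among
  functions on the whole punctured plane, so that such a function has to be constructed before
  anything is known about \<open>riemann_zeta\<close>.\<close>

definition dirichlet_zeta :: "complex \<Rightarrow> complex" where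
  "dirichlet_zeta s = (\<Sum>n. 1 / of_nat (Suc n) powr s)"

text \<open>Remainder of the Taylor expansion of \<open>x \<mapsto> x powr (1 - s)\<close> from \<open>m + 1\<close> to \<open>m + 2\<close>. Summing
  over \<open>m\<close> telescopes and expresses \<open>(s - 1) \<zeta>(s)\<close> through \<open>\<zeta>(s + 1), \<zeta>(s + 2), \<dots>\<close>; this
  extends \<open>\<zeta>\<close> one unit strip further to the left at each step.\<close>
definition zeta_rem :: "nat \<Rightarrow> complex \<Rightarrow> nat \<Rightarrow> complex" where
  "zeta_rem K s m = of_nat (Suc (Suc m)) powr (1 - s)
     - (\<Sum>k\<le>K. ((1 - s) gchoose k) * of_nat (Suc m) powr (1 - s - of_nat k))"

text \<open>Taylor's theorem on the ray from \<open>m + 1\<close>: the derivative of order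
  \<open>K + 1\<close> has modulus proportional to \<open>x powr (- (Re s + K))\<close>, and the
  hypothesis puts its maximum at the left end. Each further order gains one power of
  \<open>m\<close>, and with it a unit strip of convergence.\<close>

lemma norm_zeta_rem_le:
  assumes "0 \<le> Re s + real K"
  shows "norm (zeta_rem K s m) \<le>
    norm (\<Prod>i=0..<Suc K. 1 - s - of_nat i) / fact K * real (Suc m) powr (- (Re s + real K))"
proof -
  define S where "S = complex_of_real ` {real (Suc m)..}"
  define c where "c i = (\<Prod>j=0..<i. 1 - s - of_nat j)" for i
  define f where "f i x = c i * x powr (1 - s - of_nat i)" for i and x :: complex
  define w where "w = complex_of_real (real (Suc m))"
  define z where "z = complex_of_real (real (Suc (Suc m)))"
  have "norm (f 0 z - (\<Sum>i\<le>K. f i w * (z - w) ^ i / fact i))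
          \<le> (norm (c (Suc K)) * real (Suc m) powr (- (Re s + real K))) * norm (z - w) ^ Suc K / fact K"
  proof (rule field_Taylor[where S = S])
    show "convex S"
      unfolding S_def by (intro convex_linear_image bounded_linear.linear bounded_linear_of_real) auto
    show "w \<in> S" "z \<in> S" unfolding S_def w_def z_def by (intro imageI; simp)+
  next
    fix i x assume x: "x \<in> S"
    then obtain y where y: "x = of_real y" "y \<ge> real (Suc m)" by (auto simp: S_def)
    then have nz: "x \<notin> \<real>\<^sub>\<le>\<^sub>0" by (auto simp: complex_nonpos_Reals_iff)
    have "(f i has_field_derivative c i * ((1 - s - of_nat i) * x powr (1 - s - of_nat i - 1))) (at x)"
      unfolding f_def by (intro DERIV_cmult has_field_derivative_powr nz)
    also have "c i * ((1 - s - of_nat i) * x powr (1 - s - of_nat i - 1)) = f (Suc i) x"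
      by (simp add: f_def c_def algebra_simps)
    finally show "(f i has_field_derivative f (Suc i) x) (at x within S)"
      by (rule has_field_derivative_at_within)
  next
    fix x assume x: "x \<in> S"
    then obtain y where y: "x = of_real y" "y \<ge> real (Suc m)" by (auto simp: S_def)
    have "norm (x powr (1 - s - of_nat (Suc K))) = y powr (- (Re s + real K))"
      using y by (subst norm_powr_real_powr) auto
    also have "\<dots> \<le> real (Suc m) powr (- (Re s + real K))"
      using y assms by (intro powr_mono2') auto
    finally show "norm (f (Suc K) x) \<le> norm (c (Suc K)) * real (Suc m) powr (- (Re s + real K))"
      unfolding f_def norm_mult by (rule mult_left_mono) auto
  qed
  moreover have zw: "z - w = 1" by (simp add: z_def w_def)
  moreover have "f i w / fact i = ((1 - s) gchoose i) * of_nat (Suc m) powr (1 - s - of_nat i)" for i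
    unfolding f_def c_def w_def by (simp add: gbinomial_prod_rev)
  moreover have "f 0 z = of_nat (Suc (Suc m)) powr (1 - s)"
    unfolding f_def c_def z_def by simp
  ultimately show ?thesis
    unfolding zeta_rem_def c_def by simp
qed

lemma holomorphic_zeta_rem: "(\<lambda>s. zeta_rem K s m) holomorphic_on A"
  unfolding zeta_rem_def gbinomial_prod_rev
  by (intro holomorphic_intros) (auto simp del: of_nat_Suc)

lemma summable_Suc_powr: "p > 1 \<Longrightarrow> summable (\<lambda>n. real (Suc n) powr (- p))"
  using summable_Suc_iff[of "\<lambda>n. real n powr (- p)"] summable_real_powr_iff[of "-p"] by auto

lemma holomorphic_suminf:
  fixes f :: "nat \<Rightarrow> complex \<Rightarrow> complex"
  assumes "open S" and "\<And>n. f n holomorphic_on S"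
    and "\<And>z. z \<in> S \<Longrightarrow> \<exists>d>0. cball z d \<subseteq> S \<and>
           (\<exists>M. summable M \<and> (\<forall>n. \<forall>w\<in>cball z d. norm (f n w) \<le> M n))"
  shows "(\<lambda>z. \<Sum>n. f n z) holomorphic_on S"
proof (rule holomorphic_uniform_sequence[OF \<open>open S\<close>, of "\<lambda>n z. \<Sum>i<n. f i z"])
  show "(\<lambda>z. \<Sum>i<n. f i z) holomorphic_on S" for n
    by (intro holomorphic_intros assms)
  show "\<exists>d>0. cball z d \<subseteq> S \<and>
      uniform_limit (cball z d) (\<lambda>n z. \<Sum>i<n. f i z) (\<lambda>z. \<Sum>n. f n z) sequentially"
    if "z \<in> S" for z
  proof -
    obtain d M where d: "d > 0" "cball z d \<subseteq> S" and M: "summable M" "\<And>n w. w \<in> cball z d \<Longrightarrow> norm (f n w) \<le> M n"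
      using assms(3)[OF \<open>z \<in> S\<close>] by blast
    have "uniform_limit (cball z d) (\<lambda>n z. \<Sum>i<n. f i z) (\<lambda>z. \<Sum>n. f n z) sequentially"
      by (rule Weierstrass_m_test[OF M(2,1)])
    with d show ?thesis by blast
  qed
qed

lemma norm_suminf_zeta_rem_le:
  assumes "Re s > 1 - real K"
  shows "norm (\<Sum>m. zeta_rem K s m) \<le>
      norm (\<Prod>i=0..<Suc K. 1 - s - of_nat i) / fact K * (\<Sum>m. real (Suc m) powr (- (Re s + real K)))"
proof -
  let ?M = "\<lambda>m. norm (\<Prod>i=0..<Suc K. 1 - s - of_nat i) / fact K * real (Suc m) powr (- (Re s + real K))"
  have le: "norm (zeta_rem K s m) \<le> ?M m" for m
    by (rule norm_zeta_rem_le) (use assms in auto)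
  have sM: "summable ?M"
    by (intro summable_mult summable_Suc_powr) (use assms in auto)
  have sn: "summable (\<lambda>m. norm (zeta_rem K s m))"
    by (rule summable_comparison_test_ev[OF _ sM]) (use le in auto)
  have "norm (\<Sum>m. zeta_rem K s m) \<le> (\<Sum>m. norm (zeta_rem K s m))"
    by (rule summable_norm[OF sn])
  also have "\<dots> \<le> (\<Sum>m. ?M m)" by (rule suminf_le[OF le sn sM])
  also have "\<dots> = norm (\<Prod>i=0..<Suc K. 1 - s - of_nat i) / fact K * (\<Sum>m. real (Suc m) powr (- (Re s + real K)))"
    by (rule suminf_mult, rule summable_Suc_powr) (use assms in auto)
  finally show "norm (\<Sum>m. zeta_rem K s m) \<le>
      norm (\<Prod>i=0..<Suc K. 1 - s - of_nat i) / fact K * (\<Sum>m. real (Suc m) powr (- (Re s + real K)))" .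
qed

lemma open_Re_gt: "open {s. Re s > a}" and connected_Re_gt: "connected {s. Re s > a}"
  by (auto simp: open_halfspace_Re_gt intro: convex_connected convex_halfspace_Re_gt)

lemma holomorphic_suminf_zeta_rem:
  "(\<lambda>s. \<Sum>m. zeta_rem K s m) holomorphic_on {s. Re s > 1 - real K}"
proof (rule holomorphic_suminf[OF open_Re_gt holomorphic_zeta_rem])
  fix s assume "s \<in> {s. Re s > 1 - real K}"
  then have s: "Re s > 1 - real K" by simp
  define d where "d = (Re s - (1 - real K)) / 2"
  have d: "d > 0" using s by (simp add: d_def)
  have Re_ge: "Re w \<ge> Re s - d" if "w \<in> cball s d" for w
    using that abs_Re_le_cmod[of "s - w"] by (auto simp: dist_norm)
  define P where "P = (\<lambda>w::complex. \<Prod>i=0..<Suc K. 1 - w - of_nat i)"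
  have "compact (P ` cball s d)"
    unfolding P_def by (intro compact_continuous_image continuous_intros) auto
  then have "bounded (P ` cball s d)" by (rule compact_imp_bounded)
  then obtain B where B: "\<And>w. w \<in> cball s d \<Longrightarrow> norm (P w) \<le> B"
    unfolding bounded_iff by blast
  define M where "M m = B / fact K * real (Suc m) powr (- (Re s - d + real K))" for m
  have "summable M" unfolding M_def
    by (intro summable_mult summable_Suc_powr) (use s in \<open>auto simp: d_def field_simps\<close>)
  moreover have "norm (zeta_rem K w n) \<le> M n" if w: "w \<in> cball s d" for w n
  proof -
    have "norm (zeta_rem K w n) \<le> norm (P w) / fact K * real (Suc n) powr (- (Re w + real K))"
      unfolding P_def by (rule norm_zeta_rem_le) (use Re_ge[OF w] s in \<open>auto simp: d_def field_simps\<close>)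
    also have "\<dots> \<le> M n"
      unfolding M_def using B[OF w] Re_ge[OF w] order_trans[OF norm_ge_zero B[OF w]]
      by (intro mult_mono divide_right_mono powr_mono) auto
    finally show ?thesis .
  qed
  moreover have "cball s d \<subseteq> {s. Re s > 1 - real K}"
    using Re_ge s by (fastforce simp: d_def field_simps)
  ultimately show "\<exists>d>0. cball s d \<subseteq> {s. Re s > 1 - real K} \<and>
           (\<exists>M. summable M \<and> (\<forall>n. \<forall>w\<in>cball s d. norm (zeta_rem K w n) \<le> M n))"
    using d by blast
qed

lemma summable_dirichlet_zeta:
  assumes "Re s > 1"
  shows "summable (\<lambda>n. 1 / (of_nat (Suc n) :: complex) powr s)"
proof (rule summable_norm_cancel)
  have "norm (1 / (of_nat (Suc n) :: complex) powr s) = real (Suc n) powr (- Re s)" for n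
    using norm_powr_real_powr[of "of_nat (Suc n)" s]
    by (simp add: norm_divide powr_minus_divide del: of_nat_Suc)
  then show "summable (\<lambda>n. norm (1 / (of_nat (Suc n) :: complex) powr s))"
    using summable_Suc_powr[OF assms] by simp
qed

text \<open>Differences of consecutive powers telescope to -1, the term \<open>k = 1\<close> gives
  \<open>(1 - s) \<zeta>(s)\<close>, and the terms with \<open>k \<ge> 2\<close> give zeta at
  \<open>u = s + k - 1\<close>. The latter are written through \<open>(u - 1) \<zeta>(u)\<close>,
  the pole-free function that the continuation propagates.\<close>

lemma zeta_rem_telescope:
  assumes s: "Re s > 1" and K: "K \<ge> 1"
  shows "(s - 1) * dirichlet_zeta s = 1 + (\<Sum>m. zeta_rem K s m)
    - (\<Sum>k=2..K. ((1 - s) gchoose (k - 1)) / of_nat k *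
         ((s + of_nat (k - 1) - 1) * dirichlet_zeta (s + of_nat (k - 1))))"
proof -
  define a where "a m = (of_nat (Suc m) :: complex) powr (1 - s)" for m
  have norm_a: "norm (a m) = real (Suc m) powr (1 - Re s)" for m
    unfolding a_def by (subst norm_powr_real_powr) auto
  have "(\<lambda>m. real (Suc m) powr (1 - Re s)) \<longlonglongrightarrow> 0"
    by (intro tendsto_neg_powr filterlim_compose[OF filterlim_real_sequentially filterlim_Suc]) (use s in auto)
  then have "a \<longlonglongrightarrow> 0"
    by (intro tendsto_norm_zero_cancel[of a]) (simp add: norm_a)
  then have "(\<lambda>m. a (Suc m) - a m) sums (0 - a 0)"
    by (rule telescope_sums)
  then have tel: "(\<lambda>m. a (Suc m) - a m) sums (-1)" by (simp add: a_def)
  have sm: "(\<lambda>m. ((1 - s) gchoose k) * of_nat (Suc m) powr (1 - s - of_nat k)) sums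
      (((1 - s) gchoose k) * dirichlet_zeta (s + of_nat (k - 1)))" if "k \<ge> 1" for k
  proof -
    have "(1 - s - of_nat k) = - (s + of_nat (k - 1))"
      using that by (simp add: of_nat_diff)
    then have "(of_nat (Suc m) :: complex) powr (1 - s - of_nat k) = 1 / of_nat (Suc m) powr (s + of_nat (k - 1))" for m
      by (simp only: powr_minus_divide)
    moreover have "(\<lambda>m. 1 / (of_nat (Suc m) :: complex) powr (s + of_nat (k - 1))) sums dirichlet_zeta (s + of_nat (k - 1))"
      unfolding dirichlet_zeta_def by (intro summable_sums summable_dirichlet_zeta) (use s in auto)
    ultimately show ?thesis by (simp only: sums_mult)
  qed
  have "(\<lambda>m. (a (Suc m) - a m) - (\<Sum>k=1..K. ((1 - s) gchoose k) * of_nat (Suc m) powr (1 - s - of_nat k)))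
      sums (-1 - (\<Sum>k=1..K. ((1 - s) gchoose k) * dirichlet_zeta (s + of_nat (k - 1))))"
    by (intro sums_diff tel sums_sum sm) auto
  moreover have "(a (Suc m) - a m) - (\<Sum>k=1..K. ((1 - s) gchoose k) * of_nat (Suc m) powr (1 - s - of_nat k))
      = zeta_rem K s m" for m
  proof -
    have "{..K} = insert 0 {1..K}" by auto
    then show ?thesis unfolding zeta_rem_def a_def by simp
  qed
  ultimately have "(\<Sum>m. zeta_rem K s m) = -1 - (\<Sum>k=1..K. ((1 - s) gchoose k) * dirichlet_zeta (s + of_nat (k - 1)))"
    by (simp add: sums_iff)
  also have "{1..K} = insert 1 {2..K}" using K by auto
  also have "(\<Sum>k\<in>insert 1 {2..K}. ((1 - s) gchoose k) * dirichlet_zeta (s + of_nat (k - 1))) =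
     (1 - s) * dirichlet_zeta s + (\<Sum>k=2..K. ((1 - s) gchoose k) * dirichlet_zeta (s + of_nat (k - 1)))"
    by (subst sum.insert) auto
  also have "(\<Sum>k=2..K. ((1 - s) gchoose k) * dirichlet_zeta (s + of_nat (k - 1))) =
     - (\<Sum>k=2..K. ((1 - s) gchoose (k - 1)) / of_nat k *
         ((s + of_nat (k - 1) - 1) * dirichlet_zeta (s + of_nat (k - 1))))"
    unfolding sum_negf[symmetric]
  proof (rule sum.cong)
    fix k assume k: "k \<in> {2..K}"
    then obtain j where j: "k = Suc j" by (cases k) auto
    \<comment> \<open>The last factor of the binomial coefficient,
      \<open>1 - s - j = - ((s + j) - 1)\<close>, is the one that cancels the pole of zeta at
      \<open>s + j = 1\<close>.\<close>
    have "((1 - s) gchoose Suc j) = ((1 - s) gchoose j) / of_nat (Suc j) * (1 - s - of_nat j)"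
      using gbinomial_absorb_comp[of "1 - s" j] gbinomial_absorption[of j "1 - s"]
      by (simp add: field_simps gbinomial_prod_rev del: of_nat_Suc)
    also have "1 - s - of_nat j = - (s + of_nat j - 1)" by simp
    finally show "((1 - s) gchoose k) * dirichlet_zeta (s + of_nat (k - 1)) =
       - (((1 - s) gchoose (k - 1)) / of_nat k * ((s + of_nat (k - 1) - 1) * dirichlet_zeta (s + of_nat (k - 1))))"
      unfolding j diff_Suc_1 by (simp only: mult_minus_left mult_minus_right mult.assoc)
  qed auto
  finally show ?thesis by (simp add: algebra_simps)
qed

lemma zeta_continuation_half_plane:
  "\<exists>Z. Z holomorphic_on {s. Re s > - real K} \<and> (\<forall>s. Re s > 1 \<longrightarrow> Z s = (s - 1) * dirichlet_zeta s)"
proof (induction K)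
  case 0
  show ?case
  proof (intro exI[of _ "\<lambda>s. 1 + (\<Sum>m. zeta_rem 1 s m)"] conjI allI impI)
    show "(\<lambda>s. 1 + (\<Sum>m. zeta_rem 1 s m)) holomorphic_on {s. Re s > - real 0}"
      using holomorphic_suminf_zeta_rem[of 1] by (intro holomorphic_intros) simp
  qed (use zeta_rem_telescope[of _ 1] in auto)
next
  case (Suc K)
  then obtain Z where Z: "Z holomorphic_on {s. Re s > - real K}"
    "\<And>s. Re s > 1 \<Longrightarrow> Z s = (s - 1) * dirichlet_zeta s" by auto
  \<comment> \<open>Order \<open>K + 2\<close> makes the remainder sum holomorphic for
    \<open>Re s > - (K + 1)\<close>; the shifts \<open>k - 1\<close> are at least 1 and so lead into
    the half-plane of the induction hypothesis.\<close>
  let ?Z = "\<lambda>s. 1 + (\<Sum>m. zeta_rem (K + 2) s m)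
    - (\<Sum>k=2..K+2. ((1 - s) gchoose (k - 1)) / of_nat k * Z (s + of_nat (k - 1)))"
  show ?case
  proof (intro exI[of _ ?Z] conjI allI impI)
    have "(\<lambda>s. \<Sum>m. zeta_rem (K + 2) s m) holomorphic_on {s. Re s > - real (Suc K)}"
      using holomorphic_suminf_zeta_rem[of "K + 2"] by (rule holomorphic_on_subset) auto
    moreover have "(\<lambda>s. Z (s + of_nat (k - 1))) holomorphic_on {s. Re s > - real (Suc K)}"
      if "k \<in> {2..K+2}" for k
    proof -
      have "(\<lambda>s. s + of_nat (k - 1)) ` {s. Re s > - real (Suc K)} \<subseteq> {s. Re s > - real K}"
        using that by auto
      then have "(Z \<circ> (\<lambda>s. s + of_nat (k - 1))) holomorphic_on {s. Re s > - real (Suc K)}"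
        by (intro holomorphic_on_compose_gen[OF _ Z(1)] holomorphic_intros)
      then show ?thesis by (simp only: o_def)
    qed
    ultimately show "?Z holomorphic_on {s. Re s > - real (Suc K)}"
      unfolding gbinomial_prod_rev by (intro holomorphic_intros) auto
  next
    fix s assume s: "1 < Re s"
    show "?Z s = (s - 1) * dirichlet_zeta s"
      unfolding zeta_rem_telescope[OF s, of "K + 2", simplified]
      using s by (subst Z(2)) auto
  qed
qed

text \<open>By the identity theorem the continuations to nested half-planes agree, so each point may
  use any half-plane that contains it. This existence gives the choice operator in
  \<open>riemann_zeta\<close> its content.\<close>

lemma riemann_zeta_exists:
  "\<exists>f. f holomorphic_on (- {1}) \<and> (\<forall>s. Re s > 1 \<longrightarrow> f s = dirichlet_zeta s)"
proof -
  obtain Z where Z: "\<And>K. Z K holomorphic_on {s. Re s > - real K}"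
    "\<And>K s. Re s > 1 \<Longrightarrow> Z K s = (s - 1) * dirichlet_zeta s"
    using zeta_continuation_half_plane by metis
  define N where "N s = nat \<lceil>- Re s\<rceil> + 1" for s
  define W where "W s = Z (N s) s" for s
  have N: "Re s > - real (N s)" for s
    unfolding N_def by linarith
  have agree: "Z K s = Z L s" if "Re s > - real K" "Re s > - real L" for K L s
  proof (rule analytic_continuation_open[of "{s. Re s > 1}" "{s. Re s > - real (min K L)}" "Z K" "Z L"])
    show "{s. Re s > 1} \<noteq> {}" by (auto intro: exI[of _ 2])
    show "Z K holomorphic_on {s. Re s > - real (min K L)}"
      by (rule holomorphic_on_subset[OF Z(1)]) auto
    show "Z L holomorphic_on {s. Re s > - real (min K L)}"
      by (rule holomorphic_on_subset[OF Z(1)]) auto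
  qed (use that Z(2) in \<open>auto simp: open_Re_gt connected_Re_gt min_def\<close>)
  have "W holomorphic_on UNIV"
  proof (rule holomorphic_on_open[THEN iffD2, OF open_UNIV], intro ballI)
    fix s
    have "Z (N s) field_differentiable at s"
      using Z(1)[of "N s"] N[of s] open_Re_gt[of "- real (N s)"]
      by (auto intro: holomorphic_on_imp_differentiable_at)
    then obtain D where "(Z (N s) has_field_derivative D) (at s)"
      by (auto simp: field_differentiable_def)
    then have "(W has_field_derivative D) (at s)"
    proof (rule has_field_derivative_transform_within_open)
      show "open {u. Re u > - real (N s)}" by (rule open_Re_gt)
      show "s \<in> {u. Re u > - real (N s)}" using N[of s] by simp
      show "Z (N s) u = W u" if "u \<in> {u. Re u > - real (N s)}" for u
        unfolding W_def using agree[of "N s" u "N u"] N[of u] that by auto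
    qed
    then show "\<exists>D. (W has_field_derivative D) (at s)" by blast
  qed
  then have "(\<lambda>s. W s / (s - 1)) holomorphic_on (- {1})"
    by (intro holomorphic_intros) (auto intro: holomorphic_on_subset)
  moreover have "W s / (s - 1) = dirichlet_zeta s" if "Re s > 1" for s
    using that by (auto simp: W_def Z(2))
  ultimately show ?thesis by blast
qed

lemma holomorphic_riemann_zeta: "riemann_zeta holomorphic_on (- {1})"
  and riemann_zeta_eq_dirichlet: "Re s > 1 \<Longrightarrow> riemann_zeta s = dirichlet_zeta s"
proof -
  have "riemann_zeta holomorphic_on (- {1}) \<and> (\<forall>s. Re s > 1 \<longrightarrow> riemann_zeta s = dirichlet_zeta s)"
    using someI_ex[OF riemann_zeta_exists] unfolding riemann_zeta_def dirichlet_zeta_def .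
  then show "riemann_zeta holomorphic_on (- {1})"
    and "Re s > 1 \<Longrightarrow> riemann_zeta s = dirichlet_zeta s" by auto
qed

text \<open>The function \<open>(s - 1) \<zeta>(s)\<close> on \<open>Re s > 0\<close>, including its value at \<open>s = 1\<close>, where
  \<^const>\<open>riemann_zeta\<close> is unspecified.\<close>
definition zeta_reg :: "complex \<Rightarrow> complex" where
  "zeta_reg s = 1 + (\<Sum>m. zeta_rem 1 s m)"

lemma holomorphic_zeta_reg: "zeta_reg holomorphic_on {s. Re s > 0}"
  unfolding zeta_reg_def using holomorphic_suminf_zeta_rem[of 1] by (intro holomorphic_intros) simp

lemma zeta_reg_1: "zeta_reg 1 = 1"
proof -
  have "zeta_rem 1 1 m = 0" for m
    unfolding zeta_rem_def by (simp add: gbinomial_prod_rev del: of_nat_Suc)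
  then show ?thesis by (simp add: zeta_reg_def)
qed

lemma zeta_reg_eq:
  assumes "Re s > 0" "s \<noteq> 1"
  shows "zeta_reg s = riemann_zeta s * (s - 1)"
proof (rule analytic_continuation_open[of "{s. Re s > 1}" "{s. Re s > 0} - {1}" zeta_reg "\<lambda>s. riemann_zeta s * (s - 1)"])
  show "{s. Re s > 1} \<noteq> {}" by (auto intro: exI[of _ 2])
  show "connected ({s. 0 < Re s} - {1})"
    by (rule connected_open_delete[OF open_Re_gt connected_Re_gt]) simp
  show "(\<lambda>s. riemann_zeta s * (s - 1)) holomorphic_on {s. 0 < Re s} - {1}"
    by (intro holomorphic_intros) (auto intro: holomorphic_on_subset[OF holomorphic_riemann_zeta])
  show "zeta_reg z = riemann_zeta z * (z - 1)" if "z \<in> {s. 1 < Re s}" for z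
    using that zeta_rem_telescope[of z 1] by (auto simp: zeta_reg_def riemann_zeta_eq_dirichlet mult.commute)
qed (use assms in \<open>auto intro!: open_Re_gt open_Diff holomorphic_on_subset[OF holomorphic_zeta_reg]\<close>)

text \<open>The remainder of order 1 carries the factor \<open>(1 - s) * s\<close>, hence the
  quadratic growth; the series next to it is largest on \<open>Re s = 1/2\<close>, where its
  exponent is \<open>-3/2\<close>.\<close>

lemma zeta_reg_bound:
  "\<exists>C\<ge>1. \<forall>s. Re s \<ge> 1/2 \<longrightarrow> norm (zeta_reg s) \<le> C * (1 + norm s) ^ 2"
proof -
  define B where "B = (\<Sum>m. real (Suc m) powr (- (3/2)))"
  have B: "B \<ge> 0" unfolding B_def by (intro suminf_nonneg summable_Suc_powr) auto
  have "norm (zeta_reg s) \<le> (1 + B) * (1 + norm s) ^ 2" if s: "Re s \<ge> 1/2" for s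
  proof -
    have "norm (zeta_reg s) \<le> 1 + norm (\<Sum>m. zeta_rem 1 s m)"
      unfolding zeta_reg_def by (rule order_trans[OF norm_triangle_ineq]) simp
    also have "norm (\<Sum>m. zeta_rem 1 s m) \<le> norm ((1 - s) * s) * (\<Sum>m. real (Suc m) powr (- (Re s + 1)))"
      using norm_suminf_zeta_rem_le[of 1 s] s by (simp add: norm_mult)
    also have "\<dots> \<le> norm ((1 - s) * s) * B"
      unfolding B_def
      by (intro mult_left_mono suminf_le powr_mono summable_Suc_powr) (use s in auto)
    also have "norm ((1 - s) * s) \<le> (1 + norm s) * (1 + norm s)"
      unfolding norm_mult using norm_triangle_ineq4[of 1 s] by (intro mult_mono) auto
    also have "1 + (1 + norm s) * (1 + norm s) * B \<le> (1 + B) * (1 + norm s) ^ 2"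
      using B by (simp add: power2_eq_square algebra_simps)
    finally show ?thesis using B by (simp add: mult_right_mono)
  qed
  then show ?thesis using B by (intro exI[of _ "1 + B"]) auto
qed

text \<open>The leading term 1 of the Dirichlet series dominates: the others sum to at most
  \<open>pi\<^sup>2 / 6 - 1 \<le> 3/4\<close> in modulus. The bound anchors the Borel-Caratheodory
  discs and makes \<open>ln |zeta_reg|\<close> nonnegative at far centres.\<close>

lemma zeta_reg_lower_bound:
  assumes s: "Re s \<ge> 2"
  shows "norm (zeta_reg s) \<ge> norm (s - 1) / 4"
proof -
  have s1: "Re s > 1" using s by simp
  define f where "f n = 1 / (of_nat (Suc n) :: complex) powr s" for n
  have sf: "summable f" unfolding f_def by (rule summable_dirichlet_zeta[OF s1])
  have nf: "norm (f n) \<le> 1 / (real n + 1)\<^sup>2" for n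
  proof -
    have "norm (f n) = real (Suc n) powr (- Re s)"
      unfolding f_def using norm_powr_real_powr[of "of_nat (Suc n)" s]
      by (simp add: norm_divide powr_minus_divide del: of_nat_Suc)
    also have "\<dots> \<le> real (Suc n) powr (- real 2)" using s by (intro powr_mono) auto
    also have "\<dots> = 1 / (real n + 1)\<^sup>2"
      by (subst powr_minus_divide, subst powr_realpow) (auto simp: add.commute)
    finally show ?thesis .
  qed
  have sq: "(\<lambda>n. 1 / (real (Suc n) + 1)\<^sup>2) sums (pi\<^sup>2 / 6 - 1)"
    using inverse_squares_sums sums_Suc_iff[of "\<lambda>n. 1 / (real n + 1)\<^sup>2" "pi\<^sup>2/6 - 1"] by (simp add: add.commute)
  have "dirichlet_zeta s = 1 + (\<Sum>n. f (Suc n))"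
  proof -
    have "dirichlet_zeta s = suminf f" unfolding dirichlet_zeta_def f_def ..
    moreover have "f 0 = 1" by (simp add: f_def)
    ultimately show ?thesis using suminf_split_head[OF sf] by simp
  qed
  moreover have "norm (\<Sum>n. f (Suc n)) \<le> pi\<^sup>2 / 6 - 1"
  proof -
    have sn: "summable (\<lambda>n. norm (f (Suc n)))"
      by (rule summable_comparison_test_ev[OF _ sums_summable[OF sq]]) (use nf[of "Suc _"] in auto)
    have "norm (\<Sum>n. f (Suc n)) \<le> (\<Sum>n. norm (f (Suc n)))" by (rule summable_norm[OF sn])
    also have "\<dots> \<le> (\<Sum>n. 1 / (real (Suc n) + 1)\<^sup>2)"
      by (rule suminf_le[OF nf sn sums_summable[OF sq]])
    also have "\<dots> = pi\<^sup>2 / 6 - 1" using sq by (simp add: sums_iff)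
    finally show ?thesis .
  qed
  moreover have "pi\<^sup>2 / 6 \<le> 7/4"
  proof -
    have "pi \<le> 3.2" using pi_less_4 pi_approx by auto
    then have "pi\<^sup>2 \<le> 3.2\<^sup>2" by (intro power_mono) auto
    then show ?thesis by (simp add: power2_eq_square)
  qed
  ultimately have "norm (dirichlet_zeta s) \<ge> 1 / 4"
    using norm_triangle_ineq2[of 1 "- (\<Sum>n. f (Suc n))"] by simp
  then have "norm (s - 1) * (1/4) \<le> norm (s - 1) * norm (dirichlet_zeta s)"
    by (rule mult_left_mono) simp
  then show ?thesis
    using s1 by (subst zeta_reg_eq) (auto simp: riemann_zeta_eq_dirichlet norm_mult mult.commute)
qed

section \<open>Jensen's inequality on the unit disc\<close>

lemma holomorphic_remove_zero:
  assumes f: "f holomorphic_on S" "open S" "connected S"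
    and w: "w \<in> S" "f w = 0" and z0: "z0 \<in> S" "f z0 \<noteq> 0"
  obtains q n where "q holomorphic_on S" "q w \<noteq> 0" "(0::nat) < n" "\<And>z. z \<in> S \<Longrightarrow> f z = (z - w) ^ n * q z"
proof -
  have "\<not> f constant_on S" unfolding constant_on_def using w z0 by metis
  then obtain g r n where n: "0 < n" and r: "0 < r" "ball w r \<subseteq> S" and g: "g holomorphic_on ball w r"
    and fg: "\<And>z. z \<in> ball w r \<Longrightarrow> f z = (z - w) ^ n * g z" and g0: "\<And>z. z \<in> ball w r \<Longrightarrow> g z \<noteq> 0"
    using holomorphic_factor_zero_nonconstant[OF f w] by metis
  define q where "q z = (if z \<in> ball w r then g z else f z / (z - w) ^ n)" for z
  have q1: "q holomorphic_on ball w r"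
    using g by (rule holomorphic_transform) (simp add: q_def)
  have "(\<lambda>z. f z / (z - w) ^ n) holomorphic_on S - {w}"
    by (intro holomorphic_intros holomorphic_on_subset[OF f(1)]) auto
  then have q2: "q holomorphic_on S - {w}"
    by (rule holomorphic_transform) (auto simp: q_def fg)
  have "q holomorphic_on (ball w r \<union> (S - {w}))"
    by (rule holomorphic_on_Un[OF q1 q2]) (use f in auto)
  also have "ball w r \<union> (S - {w}) = S" using r w by (auto simp: subset_eq)
  finally have "q holomorphic_on S" .
  moreover have "q w \<noteq> 0" using r g0 by (simp add: q_def)
  moreover have "f z = (z - w) ^ n * q z" if "z \<in> S" for z
    using fg that r n by (cases "z = w") (auto simp: q_def)
  ultimately show ?thesis using n that by blast
qed

text \<open>Induction on the number of distinct zeros in \<open>K\<close>, each removed with its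
  full multiplicity. The cofactor is zero-free on \<open>K\<close> only, so finitely many factors
  are enough even when \<open>f\<close> has infinitely many zeros in \<open>S\<close>.\<close>

lemma holomorphic_factor_compact:
  fixes f :: "complex \<Rightarrow> complex"
  assumes f: "f holomorphic_on S" "open S" "connected S" "compact K" "K \<subseteq> S"
    and z0: "z0 \<in> S" "f z0 \<noteq> 0"
  shows "\<exists>Z n h. finite Z \<and> Z \<subseteq> K \<and> (\<forall>w\<in>Z. f w = 0) \<and> h holomorphic_on S \<and> (\<forall>z\<in>K. h z \<noteq> 0) \<and>
           (\<forall>z\<in>S. f z = h z * (\<Prod>w\<in>Z. (z - w) ^ n w))"
proof -
  have fin: "finite {z\<in>K. g z = 0}" if "g holomorphic_on S" "z1 \<in> S" "g z1 \<noteq> 0" for g z1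
  proof (cases "\<exists>w\<in>K. g w = 0")
    case True
    then have "\<not> g constant_on S" unfolding constant_on_def using that f(5) by (metis subsetD)
    then show ?thesis using holomorphic_compact_finite_zeros[OF that(1) f(2-5)] by simp
  next
    case False
    then have "{z\<in>K. g z = 0} = {}" by auto
    then show ?thesis by (simp only: finite.emptyI)
  qed
  have "\<And>f. card {z\<in>K. f z = 0} = N \<Longrightarrow> f holomorphic_on S \<Longrightarrow> (\<exists>z1\<in>S. f z1 \<noteq> 0) \<Longrightarrow>
     \<exists>Z n h. finite Z \<and> Z \<subseteq> K \<and> (\<forall>w\<in>Z. f w = 0) \<and> h holomorphic_on S \<and> (\<forall>z\<in>K. h z \<noteq> 0) \<and>
           (\<forall>z\<in>S. f z = h z * (\<Prod>w\<in>Z. (z - w) ^ n w))" for N :: nat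
  proof (induction N)
    case (0 f)
    then have "{z\<in>K. f z = 0} = {}" using fin[of f] by auto
    then show ?case using 0 by (intro exI[of _ "{}"] exI[of _ "\<lambda>_. 0"] exI[of _ f]) auto
  next
    case (Suc N f)
    then obtain z1 where z1: "z1 \<in> S" "f z1 \<noteq> 0" by auto
    have "{z\<in>K. f z = 0} \<noteq> {}" using Suc.prems(1) by (intro notI) simp
    then obtain w where w: "w \<in> K" "f w = 0" by auto
    with f(5) have "w \<in> S" by auto
    from holomorphic_remove_zero[OF Suc.prems(2) f(2,3) this w(2) z1]
    obtain q n where q: "q holomorphic_on S" "q w \<noteq> 0" "(0::nat) < n" "\<And>z. z \<in> S \<Longrightarrow> f z = (z - w) ^ n * q z"
      by metis
    have zeros: "{z\<in>K. f z = 0} = insert w {z\<in>K. q z = 0}"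
      using q f(5) w by auto
    have "card {z\<in>K. q z = 0} = N"
      using Suc.prems(1) q(2) fin[OF q(1) \<open>w \<in> S\<close> q(2)] unfolding zeros by simp
    from Suc.IH[OF this q(1)] q(2) \<open>w \<in> S\<close> obtain Z m h where Z: "finite Z" "Z \<subseteq> K"
      "\<forall>w\<in>Z. q w = 0" "h holomorphic_on S" "\<forall>z\<in>K. h z \<noteq> 0" "\<forall>z\<in>S. q z = h z * (\<Prod>w\<in>Z. (z - w) ^ m w)"
      by blast
    have wZ: "w \<notin> Z" using Z(3) q(2) by auto
    have "f z = h z * (\<Prod>v\<in>insert w Z. (z - v) ^ (m(w := n)) v)" if "z \<in> S" for z
    proof -
      have "(\<Prod>v\<in>Z. (z - v) ^ (m(w := n)) v) = (\<Prod>v\<in>Z. (z - v) ^ m v)"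
        using wZ by (intro prod.cong) auto
      then show ?thesis using q(4)[OF that] Z wZ that by simp
    qed
    moreover have "\<forall>v\<in>insert w Z. f v = 0"
      using Z(2,3) w(2) q(4) f(5) by (auto simp: subset_eq)
    ultimately show ?case
      using Z w(1) by (intro exI[of _ "insert w Z"] exI[of _ "m(w := n)"] exI[of _ h]) auto
  qed
  from this[OF refl f(1)] z0 show ?thesis by blast
qed

section \<open>Jensen's inequality in the coordinate of a vertical line\<close>

text \<open>Boundary values, at \<open>w = \<i>t\<close>, of the Cayley transform \<open>w \<mapsto> (w - b) / (w + b)\<close>, which maps the
  half-plane \<open>Re w > 0\<close> onto the unit disc and \<open>b\<close> to \<open>0\<close>.\<close>
definition cayley_line :: "real \<Rightarrow> real \<Rightarrow> complex" where
  "cayley_line b t = Complex (- b) t / Complex b t"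

lemma cayley_line_eq_cis:
  assumes "b > 0"
  shows "cis (pi - 2 * arctan (t / b)) = cayley_line b t"
proof -
  define x where "x = t / b"
  have t: "t = b * x" using assms by (simp add: x_def)
  have pos: "1 + x\<^sup>2 > 0" by (smt (verit) zero_le_power2)
  have "cis (pi - 2 * arctan x) = - (cis (- arctan x) * cis (- arctan x))"
    using cos_add[of "arctan x" "arctan x"] sin_add[of "arctan x" "arctan x"]
    by (simp add: complex_eq_iff cos_diff sin_diff)
  also have "cis (- arctan x) = (1 - \<i> * x) / sqrt (1 + x\<^sup>2)"
    by (simp add: complex_eq_iff cos_arctan sin_arctan Re_divide_of_real Im_divide_of_real)
  also have "- ((1 - \<i> * x) / sqrt (1 + x\<^sup>2) * ((1 - \<i> * x) / sqrt (1 + x\<^sup>2))) = - ((1 - \<i> * x)\<^sup>2 / (1 + x\<^sup>2))"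
    using pos by (simp add: power2_eq_square flip: of_real_mult)
  also have "complex_of_real (1 + x\<^sup>2) = (1 - \<i> * x) * (1 + \<i> * x)"
    by (simp add: complex_eq_iff power2_eq_square)
  also have "- ((1 - \<i> * x)\<^sup>2 / ((1 - \<i> * x) * (1 + \<i> * x))) = - ((1 - \<i> * x) / (1 + \<i> * x))"
    by (simp add: power2_eq_square complex_eq_iff)
  also have "\<dots> = (-1 + \<i> * x) / (1 + \<i> * x)"
    by (simp add: minus_divide_left)
  also have "\<dots> = (b * (-1 + \<i> * x)) / (b * (1 + \<i> * x))"
    using assms by (subst nonzero_mult_divide_mult_cancel_left) auto
  also have "\<dots> = cayley_line b t"
  proof -
    have "Complex (- b) t = b * (-1 + \<i> * x)" "Complex b t = b * (1 + \<i> * x)"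
      by (simp_all add: complex_eq_iff t)
    then show ?thesis by (simp add: cayley_line_def)
  qed
  finally show ?thesis by (simp add: x_def)
qed

lemma norm_cayley_line: "b > 0 \<Longrightarrow> norm (cayley_line b t) = 1"
  by (simp flip: cayley_line_eq_cis)

text \<open>The angle \<open>pi - 2 * arctan (t / b)\<close> turns the mean over the circle into an
  integral over the line, and the modulus of its derivative is the Poisson kernel
  \<open>2 * b / (b\<^sup>2 + t\<^sup>2)\<close>.\<close>

lemma mean_value_cayley_line:
  assumes f: "f holomorphic_on cball 0 1" and b: "b > 0"
  shows "(\<lambda>t. 2 * b / (b\<^sup>2 + t\<^sup>2) * Re (f (cayley_line b t))) absolutely_integrable_on UNIV \<and>
         integral UNIV (\<lambda>t. 2 * b / (b\<^sup>2 + t\<^sup>2) * Re (f (cayley_line b t))) = 2 * pi * Re (f 0)"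
proof -
  have "((\<lambda>u. f u / (u - 0)) has_contour_integral (2 * of_real pi * \<i> * f 0)) (circlepath 0 1)"
    by (rule Cauchy_integral_circlepath_simple[OF f]) simp
  then have "((\<lambda>t. f (cis t) / cis t * \<i> * cis t) has_integral 2 * of_real pi * \<i> * f 0) {0..2*pi}"
    unfolding circlepath_def by (subst (asm) has_contour_integral_part_circlepath_iff) auto
  then have "((\<lambda>t. (- \<i>) * (f (cis t) / cis t * \<i> * cis t)) has_integral (- \<i>) * (2 * of_real pi * \<i> * f 0)) {0..2*pi}"
    by (rule has_integral_mult_right)
  then have "((\<lambda>t. f (cis t)) has_integral 2 * pi * f 0) {0..2*pi}"
    by (simp add: field_simps)
  then have I: "((\<lambda>t. Re (f (cis t))) has_integral 2 * pi * Re (f 0)) {0..2*pi}"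
    by (drule_tac has_integral_Re) (simp add: mult.assoc)
  define g where "g t = pi - 2 * arctan (t / b)" for t
  have "g t \<in> {0<..<2*pi}" for t
    using arctan_bounded[of "t / b"] by (auto simp: g_def)
  moreover have "y \<in> range g" if "y \<in> {0<..<2*pi}" for y
  proof
    show "y = g (b * tan ((pi - y) / 2))"
      using that b by (simp add: g_def arctan_tan diff_divide_distrib)
  qed auto
  ultimately have rg: "range g = {0<..<2*pi}" by blast
  have ab: "(\<lambda>t. Re (f (cis t))) absolutely_integrable_on {0..2*pi}"
  proof (rule absolutely_integrable_continuous_real)
    have "continuous_on {0..2*pi} (f \<circ> cis)"
      by (rule continuous_on_compose) (auto intro!: continuous_intros continuous_on_subset[OF holomorphic_on_imp_continuous_on[OF f]])
    then show "continuous_on {0..2*pi} (\<lambda>t. Re (f (cis t)))"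
      by (auto simp: o_def intro!: continuous_intros)
  qed
  \<comment> \<open>The angles 0 and \<open>2 * pi\<close> both give the point 1, which corresponds
    to infinity on the line and is not attained.\<close>
  have "(\<lambda>t. Re (f (cis t))) absolutely_integrable_on {0<..<2*pi} \<and>
        integral {0<..<2*pi} (\<lambda>t. Re (f (cis t))) = 2 * pi * Re (f 0)"
    using integral_open_interval_real[of 0 "2*pi" "\<lambda>t. Re (f (cis t))"] integral_unique[OF I]
    by (auto intro: set_integrable_subset[OF ab])
  then have "(\<lambda>t. Re (f (cis t))) absolutely_integrable_on range g \<and>
        integral (range g) (\<lambda>t. Re (f (cis t))) = 2 * pi * Re (f 0)" by (simp only: rg)
  moreover have "(g has_field_derivative - (2 * b / (b\<^sup>2 + t\<^sup>2))) (at t within UNIV)" for t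
  proof -
    have pos: "b\<^sup>2 + t\<^sup>2 > 0" using b by (simp add: add_pos_nonneg)
    have "(g has_field_derivative (0 - 2 * (inverse (1 + (t / b)\<^sup>2) * (1 / b)))) (at t)"
      unfolding g_def using b by (auto intro!: derivative_eq_intros)
    also have "0 - 2 * (inverse (1 + (t / b)\<^sup>2) * (1 / b)) = - (2 * b / (b\<^sup>2 + t\<^sup>2))"
      using pos b by (simp add: field_simps power2_eq_square)
    finally show ?thesis .
  qed
  moreover have "inj g"
    unfolding g_def using b by (auto intro!: injI simp: arctan_eq_iff)
  ultimately have "(\<lambda>t. \<bar>- (2 * b / (b\<^sup>2 + t\<^sup>2))\<bar> * Re (f (cis (g t)))) absolutely_integrable_on UNIV \<and>
        integral UNIV (\<lambda>t. \<bar>- (2 * b / (b\<^sup>2 + t\<^sup>2))\<bar> * Re (f (cis (g t)))) = 2 * pi * Re (f 0)"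
    by (subst has_absolute_integral_change_of_variables_1') auto
  moreover have "\<bar>- (2 * b / (b\<^sup>2 + t\<^sup>2))\<bar> = 2 * b / (b\<^sup>2 + t\<^sup>2)" for t using b by simp
  moreover have "cis (g t) = cayley_line b t" for t unfolding g_def by (rule cayley_line_eq_cis[OF b])
  ultimately show ?thesis by (simp only:)
qed

text \<open>For a zero-free function this is an equality, the mean value property for the real part
  of a holomorphic logarithm; the work lies in trading \<open>F\<close> for such a function. Zeros
  on the circle would survive the trade, so they are excluded here, and later applications choose
  circles that avoid them.\<close>

lemma jensen_inequality_cayley_line:
  assumes F: "F holomorphic_on ball 0 R" "R > 1" and F0: "F 0 \<noteq> 0"
    and Fs: "\<And>z. norm z = 1 \<Longrightarrow> F z \<noteq> 0" and b: "b > 0"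
  shows "(\<lambda>t. 2 * b / (b\<^sup>2 + t\<^sup>2) * ln (norm (F (cayley_line b t)))) absolutely_integrable_on UNIV \<and>
         integral UNIV (\<lambda>t. 2 * b / (b\<^sup>2 + t\<^sup>2) * ln (norm (F (cayley_line b t)))) \<ge> 2 * pi * ln (norm (F 0))"
proof -
  obtain Z n h where Z: "finite Z" "Z \<subseteq> cball 0 1" "\<forall>w\<in>Z. F w = 0" and h: "h holomorphic_on ball 0 R"
    "\<forall>z\<in>cball 0 1. h z \<noteq> 0" and Fh: "\<forall>z\<in>ball 0 R. F z = h z * (\<Prod>w\<in>Z. (z - w) ^ n w)"
    using holomorphic_factor_compact[OF F(1) open_ball connected_ball compact_cball, of 0 1 0] F0 F(2)
    by (auto simp: subset_eq)
  have Zn: "norm w < 1" if "w \<in> Z" for w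
    using that Z Fs[of w] by (force simp: less_le)
  \<comment> \<open>Replacing \<open>z - w\<close> by \<open>1 - cnj w * z\<close> keeps the modulus on the circle and can only increase it at \<open>0\<close>.\<close>
  define H where "H z = h z * (\<Prod>w\<in>Z. (1 - cnj w * z) ^ n w)" for z
  have H: "H holomorphic_on cball 0 1"
    unfolding H_def using F(2) by (intro holomorphic_intros holomorphic_on_subset[OF h(1)]) auto
  have Hnz: "H z \<noteq> 0" if "z \<in> cball 0 1" for z
  proof -
    have "1 - cnj w * z \<noteq> 0" if w: "w \<in> Z" for w
    proof
      assume "1 - cnj w * z = 0"
      then have "norm (cnj w * z) = 1" by (metis eq_iff_diff_eq_0 norm_one)
      moreover have "norm w * norm z \<le> norm w * 1" using \<open>z \<in> cball 0 1\<close> by (intro mult_left_mono) auto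
      ultimately show False using Zn[OF w] by (simp add: norm_mult)
    qed
    then show ?thesis using h(2) that Z(1) by (simp add: H_def)
  qed
  have Hs: "norm (H z) = norm (F z)" if z: "norm z = 1" for z
  proof -
    have "norm (1 - cnj w * z) = norm (z - w)" for w
    proof -
      have "z * cnj z = 1" using z by (simp add: complex_norm_square[symmetric])
      then have "1 - cnj w * z = z * cnj (z - w)" by (simp add: algebra_simps)
      then show ?thesis using z by (simp add: norm_mult del: complex_cnj_diff)
    qed
    then show ?thesis
      using Fh z F(2) by (simp add: H_def norm_mult prod_norm[symmetric] norm_power)
  qed
  have H0: "norm (F 0) \<le> norm (H 0)"
  proof -
    have "norm (F 0) = norm (h 0) * (\<Prod>w\<in>Z. norm w ^ n w)"
      using Fh F(2) by (simp add: norm_mult prod_norm[symmetric] norm_power)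
    also have "\<dots> \<le> norm (h 0) * 1"
      using Zn by (intro mult_left_mono prod_le_1) (auto intro!: power_le_one intro: less_imp_le)
    finally show ?thesis by (simp add: H_def)
  qed
  obtain g where g: "g holomorphic_on cball 0 1" "\<And>z. z \<in> cball 0 1 \<Longrightarrow> H z = exp (g z)"
    using contractible_imp_holomorphic_log[OF H convex_imp_contractible[OF convex_cball] Hnz] by metis
  have lnH: "ln (norm (H z)) = Re (g z)" if "z \<in> cball 0 1" for z
    using g(2)[OF that] by simp
  have "ln (norm (F (cayley_line b t))) = Re (g (cayley_line b t))" for t
    using Hs[of "cayley_line b t"] lnH[of "cayley_line b t"] norm_cayley_line[OF b] by simp
  moreover have "ln (norm (F 0)) \<le> Re (g 0)"
    using H0 lnH[of 0] F0 by (metis centre_in_cball ln_mono zero_less_norm_iff zero_le_one)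
  ultimately show ?thesis
    using mean_value_cayley_line[OF g(1) b] by simp
qed

section \<open>Limits of integrals and integrable majorants\<close>

lemma reverse_fatou:
  fixes f :: "nat \<Rightarrow> real \<Rightarrow> real"
  assumes f: "\<And>n. f n absolutely_integrable_on UNIV" "\<And>n. integral UNIV (f n) \<ge> m"
    and h: "h absolutely_integrable_on UNIV" "\<And>n t. f n t \<le> h t"
    and g: "g \<in> borel_measurable borel" and N: "negligible N"
    and lim: "\<And>t. t \<notin> N \<Longrightarrow> (\<lambda>n. f n t) \<longlonglongrightarrow> g t"
  shows "g absolutely_integrable_on UNIV \<and> integral UNIV g \<ge> m"
proof -
  have int_eq: "integral UNIV u = integral\<^sup>L lebesgue u" if "integrable lebesgue u" for u :: "real \<Rightarrow> real"
    using integral_lebesgue[OF that] by simp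
  have ai: "u absolutely_integrable_on UNIV \<longleftrightarrow> integrable lebesgue u" for u :: "real \<Rightarrow> real"
    by (simp add: set_integrable_def)
  note f' = f(1)[unfolded ai] and h' = h(1)[unfolded ai]
  have gm: "g \<in> borel_measurable lebesgue"
    using g by (metis measurable_completion measurable_lborel2)
  have AE: "AE t in lebesgue. t \<notin> N"
    using N by (simp add: negligible_iff_null_sets AE_not_in)
  have hg: "AE t in lebesgue. 0 \<le> h t - g t"
    using AE
  proof eventually_elim
    case (elim t)
    have "g t \<le> h t" by (rule LIMSEQ_le_const2[OF lim[OF elim]]) (use h in auto)
    then show ?case by simp
  qed
  \<comment> \<open>Fatou's lemma for the nonnegative \<open>h - f n\<close>. No integrable lower
    bound for the \<open>f n\<close> is at hand; the bound \<open>m\<close> on their integrals takes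
    its place and also yields the integrability of \<open>g\<close>.\<close>
  have "(\<integral>\<^sup>+t. ennreal (h t - g t) \<partial>lebesgue) = (\<integral>\<^sup>+t. liminf (\<lambda>n. ennreal (h t - f n t)) \<partial>lebesgue)"
  proof (rule nn_integral_cong_AE)
    show "AE t in lebesgue. ennreal (h t - g t) = liminf (\<lambda>n. ennreal (h t - f n t))"
      using AE
    proof eventually_elim
      case (elim t)
      have "(\<lambda>n. ennreal (h t - f n t)) \<longlonglongrightarrow> ennreal (h t - g t)"
        by (intro tendsto_ennrealI tendsto_intros lim elim)
      then show ?case by (rule lim_imp_Liminf[symmetric, rotated]) simp
    qed
  qed
  also have "\<dots> \<le> liminf (\<lambda>n. \<integral>\<^sup>+t. ennreal (h t - f n t) \<partial>lebesgue)"
    using f' h' by (intro nn_integral_liminf) (auto dest!: borel_measurable_integrable)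
  also have "\<dots> \<le> liminf (\<lambda>n. ennreal (integral\<^sup>L lebesgue h - m))"
  proof (intro Liminf_mono always_eventually allI)
    fix n
    have "(\<integral>\<^sup>+t. ennreal (h t - f n t) \<partial>lebesgue) = ennreal (\<integral>t. h t - f n t \<partial>lebesgue)"
      using f' h' h(2) by (intro nn_integral_eq_integral) auto
    also have "(\<integral>t. h t - f n t \<partial>lebesgue) \<le> integral\<^sup>L lebesgue h - m"
      using f' h' f(2)[of n] int_eq[OF f'] by simp
    finally show "(\<integral>\<^sup>+t. ennreal (h t - f n t) \<partial>lebesgue) \<le> ennreal (integral\<^sup>L lebesgue h - m)"
      by (simp add: ennreal_leI)
  qed
  also have "\<dots> = ennreal (integral\<^sup>L lebesgue h - m)" by (simp add: Liminf_const)
  finally have le: "(\<integral>\<^sup>+t. ennreal (h t - g t) \<partial>lebesgue) \<le> ennreal (integral\<^sup>L lebesgue h - m)" .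
  have hgm: "(\<lambda>t. h t - g t) \<in> borel_measurable lebesgue"
    using gm h' by (auto dest!: borel_measurable_integrable)
  have inthg: "integrable lebesgue (\<lambda>t. h t - g t)"
    using le by (intro integrableI_nonneg hg hgm) (auto simp: top.not_eq_extremum[symmetric] top_unique)
  then have "integrable lebesgue (\<lambda>t. h t - (h t - g t))" by (rule Bochner_Integration.integrable_diff[OF h'])
  then have intg: "integrable lebesgue g" by simp
  have "ennreal (\<integral>t. h t - g t \<partial>lebesgue) \<le> ennreal (integral\<^sup>L lebesgue h - m)"
    using le nn_integral_eq_integral[OF inthg hg] by simp
  \<comment> \<open>\<open>ennreal\<close> truncates negative numbers to 0, so the real inequality
    can be read off only once the right-hand side is known to be nonnegative.\<close>
  moreover have "m \<le> integral\<^sup>L lebesgue h"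
  proof -
    have "integral UNIV (f 0) \<le> integral UNIV h"
      using f(1)[of 0] h by (intro integral_le) (auto simp: absolutely_integrable_on_def)
    then show ?thesis using f(2)[of 0] int_eq[OF h'] by simp
  qed
  ultimately have "(\<integral>t. h t - g t \<partial>lebesgue) \<le> integral\<^sup>L lebesgue h - m"
    by (subst (asm) ennreal_le_iff) auto
  then have "m \<le> integral\<^sup>L lebesgue g" using intg h' by simp
  then show ?thesis using intg int_eq ai by simp
qed

lemma absolutely_integrable_weight:
  "(\<lambda>t::real. (1 + \<bar>t\<bar>) powr (-3/2)) absolutely_integrable_on UNIV"
proof -
  have "(\<lambda>x::real. x powr (-3/2)) absolutely_integrable_on {1..}"
    using has_integral_powr_to_inf[of "-3/2" 1]
    by (intro nonnegative_absolutely_integrable_1) auto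
  moreover have "(\<lambda>t::real. 1 + t) ` {0..} = {1..}"
    by (auto simp: image_iff intro!: bexI[of _ "_ - 1"])
  moreover have "(\<lambda>t::real. 1 - t) ` {..0} = {1..}"
    by (auto simp: image_iff intro!: bexI[of _ "1 - _"])
  moreover have "(\<lambda>x::real. x powr (-3/2)) absolutely_integrable_on (\<lambda>t. 1 + t) ` {0..} \<longleftrightarrow>
      (\<lambda>t::real. \<bar>1\<bar> * (1 + t) powr (-3/2)) absolutely_integrable_on {0..}"
    by (rule absolutely_integrable_change_of_variables_1') (auto intro!: derivative_eq_intros inj_onI)
  moreover have "(\<lambda>x::real. x powr (-3/2)) absolutely_integrable_on (\<lambda>t. 1 - t) ` {..0} \<longleftrightarrow>
      (\<lambda>t::real. \<bar>-1\<bar> * (1 - t) powr (-3/2)) absolutely_integrable_on {..0}"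
    by (rule absolutely_integrable_change_of_variables_1') (auto intro!: derivative_eq_intros inj_onI)
  ultimately have "(\<lambda>t::real. (1 + t) powr (-3/2)) absolutely_integrable_on {0..}"
    "(\<lambda>t::real. (1 - t) powr (-3/2)) absolutely_integrable_on {..0}"
    by simp_all
  moreover have "(\<lambda>t::real. (1 + \<bar>t\<bar>) powr (-3/2)) absolutely_integrable_on {0..} \<longleftrightarrow>
      (\<lambda>t::real. (1 + t) powr (-3/2)) absolutely_integrable_on {0..}"
    "(\<lambda>t::real. (1 + \<bar>t\<bar>) powr (-3/2)) absolutely_integrable_on {..0} \<longleftrightarrow>
      (\<lambda>t::real. (1 - t) powr (-3/2)) absolutely_integrable_on {..0}"
    by (rule set_integrable_cong; simp)+
  ultimately have "(\<lambda>t::real. (1 + \<bar>t\<bar>) powr (-3/2)) absolutely_integrable_on {0..}"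
    "(\<lambda>t::real. (1 + \<bar>t\<bar>) powr (-3/2)) absolutely_integrable_on {..0}"
    by blast+
  then have "(\<lambda>t::real. (1 + \<bar>t\<bar>) powr (-3/2)) absolutely_integrable_on ({0..} \<union> {..0})"
    by (rule set_integrable_Un) auto
  also have "{0..} \<union> {..0} = (UNIV :: real set)" by auto
  finally show ?thesis .
qed

section \<open>Jensen's inequality on a half-plane\<close>

text \<open>Square-root growth leaves room for every logarithm and still gives the integrable
  exponent \<open>-3/2\<close> after division by a quadratic.\<close>

lemma absolutely_integrable_kernel:
  fixes u :: "real \<Rightarrow> real"
  assumes b: "b > 0" and u: "u \<in> borel_measurable borel" "\<And>t. \<bar>u t\<bar> \<le> A * sqrt (1 + \<bar>t\<bar>)"
  shows "(\<lambda>t. u t / (b\<^sup>2 + t\<^sup>2)) absolutely_integrable_on UNIV"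
proof (rule measurable_bounded_by_integrable_imp_absolutely_integrable)
  have "(\<lambda>t. u t / (b\<^sup>2 + t\<^sup>2)) \<in> borel_measurable borel"
    using u(1) by measurable
  then show "(\<lambda>t. u t / (b\<^sup>2 + t\<^sup>2)) \<in> borel_measurable (lebesgue_on UNIV)"
    by (metis lebesgue_on_UNIV_eq measurable_completion measurable_lborel2)
  define M where "M = A * (2 * (1 + 1 / b\<^sup>2))"
  show "(\<lambda>t. M * (1 + \<bar>t\<bar>) powr (-3/2)) integrable_on UNIV"
    using absolutely_integrable_weight unfolding absolutely_integrable_on_def
    by (intro integrable_on_mult_right) auto
  show "norm (u t / (b\<^sup>2 + t\<^sup>2)) \<le> M * (1 + \<bar>t\<bar>) powr (-3/2)" for t
  proof -
    define y where "y = 1 + \<bar>t\<bar>"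
    have y: "y \<ge> 1" by (simp add: y_def)
    have pos: "b\<^sup>2 + t\<^sup>2 > 0" using b by (simp add: add_pos_nonneg)
    have "y\<^sup>2 \<le> 2 + 2 * t\<^sup>2"
      using zero_le_power2[of "1 - \<bar>t\<bar>"] by (simp add: y_def power2_eq_square algebra_simps)
    also have "\<dots> \<le> 2 * (1 + 1 / b\<^sup>2) * (b\<^sup>2 + t\<^sup>2)"
      using b by (simp add: field_simps)
    finally have "1 / (b\<^sup>2 + t\<^sup>2) \<le> 2 * (1 + 1 / b\<^sup>2) / y\<^sup>2"
      using pos y by (simp add: field_simps)
    moreover have "A * sqrt y \<ge> 0" using order_trans[OF abs_ge_zero u(2)[of t]] by (simp add: y_def)
    ultimately have "\<bar>u t\<bar> * (1 / (b\<^sup>2 + t\<^sup>2)) \<le> (A * sqrt y) * (2 * (1 + 1 / b\<^sup>2) / y\<^sup>2)"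
      using u(2)[of t] pos by (intro mult_mono) (auto simp: y_def)
    also have "\<dots> = M * (sqrt y / y\<^sup>2)" by (simp add: M_def)
    also have "sqrt y / y\<^sup>2 = y powr (1/2 - 2)"
      using y by (subst powr_diff) (simp add: powr_half_sqrt powr_numeral)
    finally show ?thesis using pos by (simp add: y_def)
  qed
qed simp

lemma ln_affine_le_sqrt:
  assumes B: "B \<ge> (1::real)"
  shows "\<bar>ln (B + 2 * \<bar>t\<bar>)\<bar> \<le> (ln (2 * B) + 2) * sqrt (1 + \<bar>t\<bar>)"
proof -
  define y where "y = 1 + \<bar>t\<bar>"
  have y: "y \<ge> 1" by (simp add: y_def)
  have sq: "sqrt y \<ge> 1" using y by simp
  have "\<bar>ln (B + 2 * \<bar>t\<bar>)\<bar> = ln (B + 2 * \<bar>t\<bar>)" using B by simp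
  also have "\<dots> \<le> ln (2 * B * y)"
  proof (rule ln_mono)
    have "\<bar>t\<bar> * 1 \<le> \<bar>t\<bar> * B" using B by (intro mult_left_mono) auto
    then show "B + 2 * \<bar>t\<bar> \<le> 2 * B * y" using B by (simp add: y_def algebra_simps)
  qed (use B in auto)
  also have "\<dots> = ln (2 * B) + 2 * ln (sqrt y)" using B y by (simp add: ln_mult ln_sqrt)
  also have "\<dots> \<le> ln (2 * B) * sqrt y + 2 * sqrt y"
  proof (rule add_mono)
    show "ln (2 * B) \<le> ln (2 * B) * sqrt y" using sq B mult_left_mono[OF sq, of "ln (2 * B)"] by simp
    show "2 * ln (sqrt y) \<le> 2 * sqrt y" using ln_bound[of "sqrt y"] y by simp
  qed
  finally show ?thesis by (simp add: y_def algebra_simps)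
qed

lemma absolutely_integrable_log_growth:
  fixes b :: real
  assumes b: "b > 0" and B: "B \<ge> (1::real)"
  shows "(\<lambda>t. (A + real K * ln (B + 2 * \<bar>t\<bar>)) / (b\<^sup>2 + t\<^sup>2)) absolutely_integrable_on UNIV"
proof (rule absolutely_integrable_kernel[OF b])
  show "\<bar>A + real K * ln (B + 2 * \<bar>t\<bar>)\<bar> \<le> (\<bar>A\<bar> + real K * (ln (2 * B) + 2)) * sqrt (1 + \<bar>t\<bar>)" for t
  proof -
    have "\<bar>A + real K * ln (B + 2 * \<bar>t\<bar>)\<bar> \<le> \<bar>A\<bar> * 1 + real K * \<bar>ln (B + 2 * \<bar>t\<bar>)\<bar>"
      using abs_triangle_ineq[of A "real K * ln (B + 2 * \<bar>t\<bar>)"] by (simp add: abs_mult)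
    also have "\<dots> \<le> \<bar>A\<bar> * sqrt (1 + \<bar>t\<bar>) + real K * ((ln (2 * B) + 2) * sqrt (1 + \<bar>t\<bar>))"
      by (intro add_mono mult_left_mono ln_affine_le_sqrt B) auto
    finally show ?thesis by (simp add: algebra_simps)
  qed
qed measurable

lemma negligible_zeros_on_line:
  assumes G: "G holomorphic_on {s. Re s > \<sigma>'}" and \<sigma>: "\<sigma>' < \<sigma>" and z0: "\<sigma>' < Re z0" "G z0 \<noteq> 0"
  shows "negligible {t. G (Complex \<sigma> t) = 0}"
proof -
  have "finite {t \<in> {- real n..real n}. G (Complex \<sigma> t) = 0}" for n
  proof -
    have "compact (Complex \<sigma> ` {- real n..real n})"
      by (intro compact_continuous_image) (auto intro!: continuous_intros)
    from holomorphic_factor_compact[OF G open_Re_gt connected_Re_gt this, of z0] obtain Z m h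
      where Z: "finite Z" "\<forall>z\<in>Complex \<sigma> ` {- real n..real n}. h z \<noteq> 0"
        "\<forall>z\<in>{s. Re s > \<sigma>'}. G z = h z * (\<Prod>w\<in>Z. (z - w) ^ m w)"
      using z0 \<sigma> by (auto simp: subset_eq)
    have "t \<in> Im ` Z" if "t \<in> {- real n..real n}" "G (Complex \<sigma> t) = 0" for t
    proof -
      have "(\<Prod>w\<in>Z. (Complex \<sigma> t - w) ^ m w) = 0"
        using Z(2,3) that \<sigma> by auto
      then obtain w where "w \<in> Z" "Complex \<sigma> t = w" using Z(1) by (auto simp: prod_zero_iff)
      then show ?thesis by force
    qed
    then have "{t \<in> {- real n..real n}. G (Complex \<sigma> t) = 0} \<subseteq> Im ` Z" by auto
    then show ?thesis using Z(1) by (meson finite_imageI finite_subset)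
  qed
  then have "countable (\<Union>n. {t \<in> {- real n..real n}. G (Complex \<sigma> t) = 0})"
    by (auto intro: countable_finite)
  moreover have "{t. G (Complex \<sigma> t) = 0} \<subseteq> (\<Union>n. {t \<in> {- real n..real n}. G (Complex \<sigma> t) = 0})"
  proof
    fix t assume t: "t \<in> {t. G (Complex \<sigma> t) = 0}"
    obtain n where "\<bar>t\<bar> \<le> real n" using real_arch_simple by blast
    then show "t \<in> (\<Union>n. {t \<in> {- real n..real n}. G (Complex \<sigma> t) = 0})"
      using t by (intro UN_I[of n]) auto
  qed
  ultimately have "countable {t. G (Complex \<sigma> t) = 0}" by (rule countable_subset[rotated])
  then show ?thesis by (simp add: negligible_iff_null_sets countable_imp_null_set_lborel null_sets_completionI)
qed

text \<open>\<open>T\<close> carries the disc to the half-plane, 0 to the centre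
  \<open>\<sigma> + b\<close>, and \<open>cayley_line b t\<close> to the boundary point at height
  \<open>t\<close>; dividing the disc inequality by \<open>2 * b\<close> produces
  \<open>pi / b\<close>. Zeros inside are avoided by the choice of the radii, and zeros on the line
  only spoil the limit on a null set.\<close>

lemma jensen_inequality_half_plane:
  assumes G: "G holomorphic_on {s. Re s > \<sigma>'}" and \<sigma>: "\<sigma>' < \<sigma>" and b: "b > 0"
    and bound: "\<And>s. Re s \<ge> \<sigma> \<Longrightarrow> norm (G s) \<le> C * (1 + norm s) ^ K"
    and nz: "G (of_real (\<sigma> + b)) \<noteq> 0"
  shows "(\<lambda>t. ln (norm (G (Complex \<sigma> t))) / (b\<^sup>2 + t\<^sup>2)) absolutely_integrable_on UNIV"
    and "pi / b * ln (norm (G (of_real (\<sigma> + b)))) \<le> integral UNIV (\<lambda>t. ln (norm (G (Complex \<sigma> t))) / (b\<^sup>2 + t\<^sup>2))"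
proof -
  define T where "T z = of_real \<sigma> + of_real b * ((1 + z) / (1 - z))" for z :: complex
  define F where "F z = G (T z)" for z
  define \<psi> where "\<psi> = cayley_line b"
  have ReT: "Re (T z) > \<sigma>" if "norm z < 1" for z
  proof -
    have z: "(Re z)\<^sup>2 + (Im z)\<^sup>2 < 1" using that by (simp add: cmod_def)
    have "z \<noteq> 1" using that by auto
    then have "(1 - Re z)\<^sup>2 + (Im z)\<^sup>2 > 0"
      by (auto simp: complex_eq_iff sum_power2_gt_zero_iff)
    then have "Re ((1 + z) / (1 - z)) > 0"
      using z by (auto simp: Re_divide field_simps power2_eq_square)
    then have "b * Re ((1 + z) / (1 - z)) > 0" using b by simp
    then show ?thesis by (simp only: T_def plus_complex.sel times_complex.sel Re_complex_of_real Im_complex_of_real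
        mult_zero_left diff_zero less_add_same_cancel1)
  qed
  have holT: "T holomorphic_on ball 0 1"
    unfolding T_def by (intro holomorphic_intros) auto
  have "(G \<circ> T) holomorphic_on ball 0 1"
    by (rule holomorphic_on_compose_gen[OF holT G]) (use ReT \<sigma> in force)
  then have holF: "F holomorphic_on ball 0 1" by (simp add: F_def[abs_def] o_def)
  have F0: "F 0 = G (of_real (\<sigma> + b))" by (simp add: F_def T_def)
  have \<psi>1: "1 - \<psi> t = of_real (2 * b) / Complex b t" and \<psi>2: "1 + \<psi> t = 2 * (\<i> * of_real t) / Complex b t"
    and bt: "Complex b t \<noteq> 0" for t
  proof -
    show bt: "Complex b t \<noteq> 0" using b by (simp add: complex_eq_iff)
    show "1 - \<psi> t = of_real (2 * b) / Complex b t" "1 + \<psi> t = 2 * (\<i> * of_real t) / Complex b t"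
      unfolding \<psi>_def cayley_line_def
      by (subst eq_divide_eq, use bt in \<open>simp add: algebra_simps, simp add: complex_eq_iff\<close>)+
  qed
  have T\<psi>: "T (\<psi> t) = Complex \<sigma> t" for t
    unfolding T_def \<psi>1 \<psi>2 using b bt[of t] by (simp add: complex_eq_iff)
  have \<psi>n1: "\<psi> t \<noteq> 1" for t
    using \<psi>1[of t] b bt[of t] by auto
  have norm\<psi>: "norm (\<psi> t) = 1" for t unfolding \<psi>_def by (rule norm_cayley_line[OF b])
  \<comment> \<open>Only finitely many zeros of \<open>F\<close> lie in
    \<open>cball 0 \<rho>\<close>, so all but finitely many radii in the interval avoid
    them.\<close>
  have "\<exists>r. 1 - 1 / (real n + 2) < r \<and> r < 1 \<and> (\<forall>z. norm z = r \<longrightarrow> F z \<noteq> 0)" for n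
  proof -
    define \<rho> where "\<rho> = 1 - 1 / (real n + 3)"
    have \<rho>: "1 - 1 / (real n + 2) < \<rho>" "\<rho> < 1" "0 < \<rho>" by (auto simp: \<rho>_def field_simps)
    obtain Z m h where Z: "finite Z" "\<forall>z\<in>cball 0 \<rho>. h z \<noteq> 0"
      "\<forall>z\<in>ball 0 1. F z = h z * (\<Prod>w\<in>Z. (z - w) ^ m w)"
      using holomorphic_factor_compact[OF holF open_ball connected_ball compact_cball, of 0 \<rho> 0] nz F0 \<rho>
      by (auto simp: subset_eq)
    have "infinite ({1 - 1 / (real n + 2)<..<\<rho>} - norm ` Z)"
      using Z(1) \<rho> infinite_Ioo[of "1 - 1 / (real n + 2)" \<rho>] by (intro Diff_infinite_finite) auto
    then obtain r where r: "r \<in> {1 - 1 / (real n + 2)<..<\<rho>}" "r \<notin> norm ` Z"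
      using infinite_imp_nonempty by blast
    have "F z \<noteq> 0" if "norm z = r" for z
      using Z r that \<rho> by (auto simp: image_iff)
    then show ?thesis using r \<rho> by (intro exI[of _ r]) auto
  qed
  then obtain r where r: "\<And>n. 1 - 1 / (real n + 2) < r n" "\<And>n. r n < 1" "\<And>n z. norm z = r n \<Longrightarrow> F z \<noteq> 0"
    by metis
  have r0: "r n > 0" for n
  proof -
    have "1 / (real n + 2) < 1" by (simp add: field_simps)
    then show ?thesis using r(1)[of n] by linarith
  qed
  have rlim: "r \<longlonglongrightarrow> 1"
  proof (rule tendsto_sandwich)
    show "(\<lambda>n. 1 - 1 / (real n + 2)) \<longlonglongrightarrow> 1" by real_asymp
  qed (use r in \<open>auto intro!: always_eventually less_imp_le\<close>)
  define f where "f n t = 2 * b / (b\<^sup>2 + t\<^sup>2) * ln (norm (F (r n * \<psi> t)))" for n t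
  have f: "f n absolutely_integrable_on UNIV \<and> integral UNIV (f n) \<ge> 2 * pi * ln (norm (F 0))" for n
  proof -
    define Fr where "Fr = F \<circ> (\<lambda>z. of_real (r n) * z)"
    have "Fr holomorphic_on ball 0 (1 / r n)"
      unfolding Fr_def by (rule holomorphic_on_compose_gen[OF _ holF])
        (use r0[of n] in \<open>auto intro!: holomorphic_intros simp: norm_mult field_simps\<close>)
    then have "(\<lambda>t. 2 * b / (b\<^sup>2 + t\<^sup>2) * ln (norm (Fr (cayley_line b t)))) absolutely_integrable_on UNIV \<and>
         integral UNIV (\<lambda>t. 2 * b / (b\<^sup>2 + t\<^sup>2) * ln (norm (Fr (cayley_line b t)))) \<ge> 2 * pi * ln (norm (Fr 0))"
    proof (rule jensen_inequality_cayley_line)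
      show "1 / r n > 1" using r(2)[of n] r0[of n] by simp
      show "Fr z \<noteq> 0" if "norm z = 1" for z
        unfolding Fr_def o_def using that r0[of n] by (intro r(3)[of _ n]) (simp add: norm_mult)
    qed (use nz F0 b in \<open>auto simp: Fr_def\<close>)
    then show ?thesis by (simp add: f_def[abs_def] \<psi>_def Fr_def)
  qed
  define C' where "C' = max C 1"
  define h where "h t = 2 * b * ((ln C' + real K * ln ((1 + \<bar>\<sigma>\<bar> + 2 * b) + 2 * \<bar>t\<bar>)) / (b\<^sup>2 + t\<^sup>2))" for t
  have h: "h absolutely_integrable_on UNIV"
    unfolding h_def using b
    by (intro set_integrable_mult_right absolutely_integrable_log_growth) auto
  have fh: "f n t \<le> h t" for n t
  proof -
    define z where "z = r n * \<psi> t"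
    have nz: "norm z = r n" using r0[of n] norm\<psi>[of t] by (simp add: z_def norm_mult)
    \<comment> \<open>Moving \<open>\<psi> t\<close> radially inwards at most halves its distance to
      1, since \<open>1 - r n \<le> norm (1 - z)\<close>. Hence \<open>T z\<close> is bounded
      linearly in \<open>|t|\<close>, uniformly in \<open>n\<close>, and one majorant serves all
      radii.\<close>
    have "norm (1 - \<psi> t) \<le> norm (1 - z) + norm (z - \<psi> t)" using norm_triangle_ineq[of "1 - z" "z - \<psi> t"] by simp
    also have "norm (z - \<psi> t) = 1 - r n"
    proof -
      have "z - \<psi> t = of_real (r n - 1) * \<psi> t" by (simp add: z_def algebra_simps)
      then have "norm (z - \<psi> t) = \<bar>r n - 1\<bar>" using norm\<psi>[of t] by (simp only: norm_mult norm_of_real) simp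
      then show ?thesis using r(2)[of n] by simp
    qed
    also have "1 - r n \<le> norm (1 - z)" using norm_triangle_ineq2[of 1 z] nz by simp
    finally have "2 * b / norm (Complex b t) \<le> 2 * norm (1 - z)"
      using b by (simp add: \<psi>1 norm_divide)
    then have le: "b \<le> norm (1 - z) * norm (Complex b t)"
      using bt[of t] by (simp add: field_simps)
    have z1: "norm (1 - z) > 0" using nz r(2)[of n] by auto
    have "norm (T z) \<le> \<bar>\<sigma>\<bar> + b * (norm (1 + z) / norm (1 - z))"
      unfolding T_def by (rule order_trans[OF norm_triangle_ineq]) (use b in \<open>simp add: norm_mult norm_divide\<close>)
    also have "b * (norm (1 + z) / norm (1 - z)) \<le> b * (2 / norm (1 - z))"
      using b nz r(2)[of n] norm_triangle_ineq[of 1 z] by (intro mult_left_mono divide_right_mono) auto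
    also have "\<dots> \<le> 2 * norm (Complex b t)" using le z1 by (simp add: field_simps)
    also have "norm (Complex b t) \<le> b + \<bar>t\<bar>" using cmod_le[of "Complex b t"] b by simp
    finally have nT: "norm (T z) \<le> \<bar>\<sigma>\<bar> + 2 * b + 2 * \<bar>t\<bar>" by simp
    have Fz: "norm (F z) > 0" using r(3)[OF nz] by simp
    have "norm (F z) \<le> C * (1 + norm (T z)) ^ K"
      unfolding F_def using ReT[of z] nz r(2)[of n] by (intro bound) auto
    also have "\<dots> \<le> C' * ((1 + \<bar>\<sigma>\<bar> + 2 * b) + 2 * \<bar>t\<bar>) ^ K"
      unfolding C'_def using nT by (intro mult_mono power_mono) auto
    finally have "ln (norm (F z)) \<le> ln (C' * ((1 + \<bar>\<sigma>\<bar> + 2 * b) + 2 * \<bar>t\<bar>) ^ K)"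
      using Fz by (intro ln_mono)
    also have "\<dots> = ln C' + real K * ln ((1 + \<bar>\<sigma>\<bar> + 2 * b) + 2 * \<bar>t\<bar>)"
      using b by (subst ln_mult) (auto simp: C'_def ln_realpow)
    finally have "2 * b / (b\<^sup>2 + t\<^sup>2) * ln (norm (F z)) \<le> 2 * b / (b\<^sup>2 + t\<^sup>2) * (ln C' + real K * ln ((1 + \<bar>\<sigma>\<bar> + 2 * b) + 2 * \<bar>t\<bar>))"
      using b by (intro mult_left_mono) auto
    then show ?thesis by (simp add: f_def h_def z_def)
  qed
  define g where "g t = 2 * b * (ln (norm (G (Complex \<sigma> t))) / (b\<^sup>2 + t\<^sup>2))" for t
  have contG: "continuous_on UNIV (\<lambda>t. G (Complex \<sigma> t))"
  proof -
    have "continuous_on UNIV (G \<circ> Complex \<sigma>)"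
      by (rule continuous_on_compose)
        (use \<sigma> in \<open>auto intro!: continuous_intros continuous_on_subset[OF holomorphic_on_imp_continuous_on[OF G]]\<close>)
    then show ?thesis by (simp add: o_def)
  qed
  have gm: "g \<in> borel_measurable borel"
    unfolding g_def using borel_measurable_continuous_onI[OF contG] by measurable
  have lim: "(\<lambda>n. f n t) \<longlonglongrightarrow> g t" if t: "t \<notin> {t. G (Complex \<sigma> t) = 0}" for t
  proof -
    have "(\<lambda>n. T (r n * \<psi> t)) \<longlonglongrightarrow> T (of_real 1 * \<psi> t)"
      unfolding T_def using \<psi>n1[of t] by (intro tendsto_intros rlim) auto
    then have "(\<lambda>n. T (r n * \<psi> t)) \<longlonglongrightarrow> Complex \<sigma> t" by (simp add: T\<psi>)
    moreover have "isCont G (Complex \<sigma> t)"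
      using G \<sigma> open_halfspace_Re_gt[of \<sigma>']
      by (metis (no_types, lifting) complex.sel(1) continuous_on_eq_continuous_at holomorphic_on_imp_continuous_on mem_Collect_eq)
    ultimately have "(\<lambda>n. F (r n * \<psi> t)) \<longlonglongrightarrow> G (Complex \<sigma> t)"
      unfolding F_def by (rule isCont_tendsto_compose[rotated])
    then have "(\<lambda>n. f n t) \<longlonglongrightarrow> 2 * b / (b\<^sup>2 + t\<^sup>2) * ln (norm (G (Complex \<sigma> t)))"
      unfolding f_def using t by (intro tendsto_intros) auto
    then show ?thesis by (simp add: g_def)
  qed
  have neg: "negligible {t. G (Complex \<sigma> t) = 0}"
    by (rule negligible_zeros_on_line[OF G \<sigma> _ nz]) (use b \<sigma> in auto)
  have "g absolutely_integrable_on UNIV \<and> integral UNIV g \<ge> 2 * pi * ln (norm (F 0))"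
    by (rule reverse_fatou[where f = f, OF _ _ h fh gm neg lim]) (use f in auto)
  moreover have "integral UNIV g = 2 * b * integral UNIV (\<lambda>t. ln (norm (G (Complex \<sigma> t))) / (b\<^sup>2 + t\<^sup>2))"
    unfolding g_def by (rule integral_mult_right)
  ultimately have gi: "g absolutely_integrable_on UNIV"
    and "2 * pi * ln (norm (F 0)) \<le> 2 * b * integral UNIV (\<lambda>t. ln (norm (G (Complex \<sigma> t))) / (b\<^sup>2 + t\<^sup>2))" by auto
  then show "pi / b * ln (norm (G (of_real (\<sigma> + b)))) \<le> integral UNIV (\<lambda>t. ln (norm (G (Complex \<sigma> t))) / (b\<^sup>2 + t\<^sup>2))"
    using b by (simp add: F0 field_simps)
  have "(\<lambda>t. (1 / (2 * b)) * g t) absolutely_integrable_on UNIV"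
    using gi by (rule set_integrable_mult_right)
  moreover have "(\<lambda>t. (1 / (2 * b)) * g t) = (\<lambda>t. ln (norm (G (Complex \<sigma> t))) / (b\<^sup>2 + t\<^sup>2))"
    using b by (auto simp: g_def)
  ultimately show "(\<lambda>t. ln (norm (G (Complex \<sigma> t))) / (b\<^sup>2 + t\<^sup>2)) absolutely_integrable_on UNIV" by simp
qed

section \<open>The logarithmic integral of the zeta function\<close>

lemma zeta_log_integral_pos:
  assumes \<sigma>: "1/2 \<le> \<sigma>" "\<sigma> < 1" and \<rho>: "Re \<rho> > \<sigma>" "zeta_reg \<rho> = 0"
  shows "integral UNIV (\<lambda>t. ln (norm (zeta_reg (Complex \<sigma> t))) / ((1 - \<sigma>)\<^sup>2 + t\<^sup>2)) > 0"
proof -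
  have mem: "\<rho> \<in> {s. Re s > 0}" "1 \<in> {s. Re s > 0}" "zeta_reg 1 \<noteq> 0"
    using \<rho> \<sigma> zeta_reg_1 by auto
  obtain q0 n where q0: "q0 holomorphic_on {s. Re s > 0}" "(0::nat) < n"
    "\<And>z. z \<in> {s. Re s > 0} \<Longrightarrow> zeta_reg z = (z - \<rho>) ^ n * q0 z"
    by (rule holomorphic_remove_zero[OF holomorphic_zeta_reg open_Re_gt connected_Re_gt mem(1) \<rho>(2) mem(2,3)])
      (rule that)
  \<comment> \<open>Only one factor \<open>z - \<rho>\<close> is split off; any further multiplicity
    stays in \<open>q\<close>.\<close>
  define q where "q z = (z - \<rho>) ^ (n - 1) * q0 z" for z
  have q: "q holomorphic_on {s. Re s > 0}" unfolding q_def by (intro holomorphic_intros q0)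
  have gq: "zeta_reg z = (z - \<rho>) * q z" if "Re z > 0" for z
    using q0(2,3) that by (cases n) (auto simp: q_def)
  \<comment> \<open>Reflecting the zero in the line keeps the modulus on the line and makes it exceed \<open>1\<close> at \<open>s = 1\<close>.\<close>
  define \<rho>' where "\<rho>' = of_real (2 * \<sigma>) - cnj \<rho>"
  define G where "G z = (z - \<rho>') * q z" for z
  have G: "G holomorphic_on {s. Re s > 0}" unfolding G_def by (intro holomorphic_intros q)
  obtain C where C: "C \<ge> 1" "\<And>s. Re s \<ge> 1/2 \<Longrightarrow> norm (zeta_reg s) \<le> C * (1 + norm s) ^ 2"
    using zeta_reg_bound by auto
  define \<delta> where "\<delta> = Re \<rho> / 2"
  have \<delta>: "\<delta> > 0" using \<rho> \<sigma> by (simp add: \<delta>_def)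
  have sub: "cball \<rho> \<delta> \<subseteq> {s. Re s > 0}"
  proof
    fix z assume "z \<in> cball \<rho> \<delta>"
    then show "z \<in> {s. Re s > 0}"
      using abs_Re_le_cmod[of "\<rho> - z"] \<rho> \<sigma> by (auto simp: dist_norm \<delta>_def)
  qed
  have "compact (G ` cball \<rho> \<delta>)"
    by (intro compact_continuous_image compact_cball holomorphic_on_imp_continuous_on holomorphic_on_subset[OF G sub])
  then have "bounded (G ` cball \<rho> \<delta>)" by (rule compact_imp_bounded)
  then obtain B where B: "\<And>z. z \<in> cball \<rho> \<delta> \<Longrightarrow> norm (G z) \<le> B"
    unfolding bounded_iff by blast
  define C' where "C' = max B (C * (1 + norm (\<rho> - \<rho>') / \<delta>))"
  have C'0: "C' \<ge> 0" unfolding C'_def using C(1) \<delta> by (simp add: le_max_iff_disj)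
  \<comment> \<open>Away from \<open>\<rho>\<close> the quotient
    \<open>(s - \<rho>') / (s - \<rho>)\<close> is bounded, so \<open>G\<close> inherits the growth
    of \<open>zeta_reg\<close>; near \<open>\<rho>\<close> compactness bounds \<open>G\<close>
    directly.\<close>
  have bound: "norm (G s) \<le> C' * (1 + norm s) ^ 2" if s: "Re s \<ge> \<sigma>" for s
  proof (cases "s \<in> cball \<rho> \<delta>")
    case True
    then have "norm (G s) \<le> C' * 1" using B[OF True] by (simp add: C'_def)
    also have "\<dots> \<le> C' * (1 + norm s) ^ 2" using C'0 by (intro mult_left_mono one_le_power) auto
    finally show ?thesis .
  next
    case False
    then have d: "norm (s - \<rho>) > \<delta>" by (simp add: dist_norm norm_minus_commute)
    have "norm (s - \<rho>') \<le> norm (s - \<rho>) + norm (\<rho> - \<rho>')"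
      using norm_triangle_ineq[of "s - \<rho>" "\<rho> - \<rho>'"] by simp
    also have "\<dots> \<le> norm (s - \<rho>) + norm (\<rho> - \<rho>') * (norm (s - \<rho>) / \<delta>)"
      using d \<delta> mult_left_mono[of 1 "norm (s - \<rho>) / \<delta>" "norm (\<rho> - \<rho>')"] by simp
    also have "\<dots> = (1 + norm (\<rho> - \<rho>') / \<delta>) * norm (s - \<rho>)" by (simp add: algebra_simps)
    finally have "norm (G s) \<le> (1 + norm (\<rho> - \<rho>') / \<delta>) * norm (s - \<rho>) * norm (q s)"
      unfolding G_def norm_mult by (rule mult_right_mono) auto
    also have "\<dots> = (1 + norm (\<rho> - \<rho>') / \<delta>) * norm (zeta_reg s)"
      using gq[of s] s \<sigma> by (simp add: norm_mult)
    also have "\<dots> \<le> (1 + norm (\<rho> - \<rho>') / \<delta>) * (C * (1 + norm s) ^ 2)"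
      using \<delta> s \<sigma> by (intro mult_left_mono C(2)) auto
    also have "\<dots> \<le> C' * (1 + norm s) ^ 2"
      unfolding mult.assoc[symmetric]
      by (rule mult_right_mono) (auto simp: C'_def mult.commute)
    finally show ?thesis .
  qed
  have g1: "(1 - \<rho>) * q 1 = 1" using gq[of 1] zeta_reg_1 by simp
  \<comment> \<open>\<open>\<rho>\<close> and its mirror image have the same imaginary part, so only
    the horizontal distances to 1 count, and 1 lies on the same side of the line as
    \<open>\<rho>\<close>.\<close>
  have "1 - Re \<rho> < 1 - 2 * \<sigma> + Re \<rho>" "- (1 - Re \<rho>) < 1 - 2 * \<sigma> + Re \<rho>" using \<rho> \<sigma> by auto
  then have "\<bar>1 - Re \<rho>\<bar> < \<bar>1 - 2 * \<sigma> + Re \<rho>\<bar>" by linarith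
  then have "(1 - Re \<rho>)\<^sup>2 < (1 - 2 * \<sigma> + Re \<rho>)\<^sup>2" using power2_strict_mono by blast
  then have "norm (1 - \<rho>) < norm (1 - \<rho>')"
    by (simp add: cmod_def \<rho>'_def algebra_simps)
  moreover have "norm (1 - \<rho>) > 0" "norm (q 1) > 0" using g1 by auto
  ultimately have "norm (1 - \<rho>) * norm (q 1) < norm (1 - \<rho>') * norm (q 1)" by simp
  then have G1: "norm (G 1) > 1"
    using arg_cong[OF g1, of norm] by (simp add: G_def norm_mult)
  then have G1': "G (of_real (\<sigma> + (1 - \<sigma>))) \<noteq> 0" by auto
  have line: "norm (G (Complex \<sigma> t)) = norm (zeta_reg (Complex \<sigma> t))" for t
  proof -
    have "Complex \<sigma> t - \<rho>' = - cnj (Complex \<sigma> t - \<rho>)" by (simp add: \<rho>'_def complex_eq_iff)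
    then have "norm (Complex \<sigma> t - \<rho>') = norm (Complex \<sigma> t - \<rho>)" by (simp only: norm_minus_cancel complex_mod_cnj)
    then show ?thesis using gq[of "Complex \<sigma> t"] \<sigma> by (simp add: G_def norm_mult)
  qed
  have "pi / (1 - \<sigma>) * ln (norm (G (of_real (\<sigma> + (1 - \<sigma>)))))
     \<le> integral UNIV (\<lambda>t. ln (norm (G (Complex \<sigma> t))) / ((1 - \<sigma>)\<^sup>2 + t\<^sup>2))"
    by (rule jensen_inequality_half_plane(2)[OF G _ _ bound G1']) (use \<sigma> in auto)
  moreover have "pi / (1 - \<sigma>) * ln (norm (G (of_real (\<sigma> + (1 - \<sigma>))))) > 0"
    using G1 \<sigma> by (intro mult_pos_pos divide_pos_pos ln_gt_zero) auto
  ultimately show ?thesis by (simp add: line)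
qed

section \<open>Growth of the reciprocal in a zero-free half-plane\<close>

lemma borel_caratheodory:
  assumes L: "L holomorphic_on ball c R" "L c = 0" and A: "\<And>z. z \<in> ball c R \<Longrightarrow> Re (L z) < A"
    and \<theta>: "\<theta> < 1" and s: "s \<in> ball c R" "norm (s - c) \<le> \<theta> * R"
  shows "norm (L s) \<le> 2 * \<theta> / (1 - \<theta>) * A"
proof -
  have R: "R > 0" using s(1) by (metis ball_eq_empty empty_iff not_le)
  have A0: "A > 0" using A[of c] L(2) R by simp
  \<comment> \<open>\<open>w / (2 * A - w)\<close> maps the half-plane \<open>Re w < A\<close> into
    the unit disc and fixes 0, so Schwarz's lemma applies after rescaling the ball; the resulting
    inequality is then solved for \<open>norm (L s)\<close>.\<close>
  define \<phi> where "\<phi> z = L (c + R * z) / (2 * A - L (c + R * z))" for z :: complex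
  have mem: "c + R * z \<in> ball c R" if "norm z < 1" for z :: complex
    using that R by (simp add: dist_norm norm_mult)
  have den: "2 * A - L (c + R * z) \<noteq> 0" if "norm z < 1" for z :: complex
    using A[OF mem[OF that]] A0 by (auto simp: complex_eq_iff)
  have "(L \<circ> (\<lambda>z. c + R * z)) holomorphic_on ball 0 1"
    by (rule holomorphic_on_compose_gen[OF _ L(1)]) (use mem in \<open>auto intro!: holomorphic_intros simp del: mem_ball\<close>)
  then have "\<phi> holomorphic_on ball 0 1"
    unfolding \<phi>_def o_def by (intro holomorphic_intros) (use den in auto)
  moreover have "\<phi> 0 = 0" using L(2) by (simp add: \<phi>_def)
  moreover have "norm (\<phi> z) < 1" if z: "norm z < 1" for z
  proof -
    define w where "w = L (c + R * z)"
    have w: "Re w < A" unfolding w_def by (rule A[OF mem[OF z]])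
    have "A * (A - Re w) > 0" using w A0 by simp
    then have "(Re w)\<^sup>2 + (Im w)\<^sup>2 < (2 * A - Re w)\<^sup>2 + (Im w)\<^sup>2"
      by (simp add: power2_eq_square algebra_simps)
    then have "norm w < norm (2 * A - w)" by (simp add: cmod_def)
    then show ?thesis using den[OF z] by (simp add: \<phi>_def w_def norm_divide)
  qed
  moreover define z where "z = (s - c) / R"
  have sz: "s = c + R * z" using R by (simp add: z_def)
  have nz: "norm z \<le> \<theta>" using s(2) R by (simp add: z_def norm_divide field_simps)
  ultimately have "norm (\<phi> z) \<le> norm z"
    using \<theta> by (intro Schwarz_Lemma(1)) auto
  then have "norm (\<phi> z) \<le> \<theta>" using nz by simp
  moreover have "norm (2 * A - L s) > 0" using den[of z] nz \<theta> by (simp add: sz)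
  ultimately have "norm (L s) \<le> \<theta> * norm (2 * A - L s)"
    unfolding \<phi>_def sz[symmetric] norm_divide by (simp only: pos_divide_le_eq)
  also have "\<dots> \<le> \<theta> * (2 * A + norm (L s))"
  proof (rule mult_left_mono)
    show "norm (2 * A - L s) \<le> 2 * A + norm (L s)"
      using norm_triangle_ineq4[of "of_real (2 * A)" "L s"] A0 by simp
    show "0 \<le> \<theta>" using nz norm_ge_zero[of z] by linarith
  qed
  finally show ?thesis using \<theta> by (simp add: field_simps)
qed

text \<open>For \<open>Re s < 2\<close>, the disc about \<open>2 + i Im s\<close> of radius
  \<open>2 - \<sigma>0\<close> reaches to the edge of the zero-free half-plane, while
  \<open>s\<close> stays within the fixed fraction \<open>\<theta>\<close> of the radius. So the
  passage from an upper bound on the real part of the logarithm to a bound on its modulus costs a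
  factor independent of \<open>s\<close>, which exponentiation turns into the degree of the
  polynomial.\<close>

lemma inverse_zeta_growth:
  assumes \<sigma>0: "1/2 \<le> \<sigma>0" "\<sigma>0 < \<sigma>1" "\<sigma>1 \<le> 2" and nz: "\<And>s. Re s > \<sigma>0 \<Longrightarrow> zeta_reg s \<noteq> 0"
  shows "\<exists>C K. \<forall>s. Re s \<ge> \<sigma>1 \<longrightarrow> norm (1 / zeta_reg s) \<le> C * (1 + norm s) ^ K"
proof -
  obtain C where C: "C \<ge> 1" "\<And>s. Re s \<ge> 1/2 \<Longrightarrow> norm (zeta_reg s) \<le> C * (1 + norm s) ^ 2"
    using zeta_reg_bound by auto
  have lower: "norm (zeta_reg s) \<ge> 1 / 4" if "Re s \<ge> 2" for s
    using zeta_reg_lower_bound[OF that] complex_Re_le_cmod[of "s - 1"] that by simp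
  define R where "R = 2 - \<sigma>0"
  define \<theta> where "\<theta> = (2 - \<sigma>1) / R"
  have \<theta>: "0 \<le> \<theta>" "\<theta> < 1" and R: "0 < R" "R \<le> 2" using \<sigma>0 by (auto simp: \<theta>_def R_def field_simps)
  obtain q :: nat where q: "2 * \<theta> / (1 - \<theta>) \<le> real q" using real_arch_simple by blast
  have "norm (1 / zeta_reg s) \<le> 4 * (104 * C) ^ q * (1 + norm s) ^ (2 * q)" if s: "Re s \<ge> \<sigma>1" for s
  proof -
    \<comment> \<open>On the disc \<open>1 + norm z \<le> 5 * (1 + norm s)\<close>, whose square
      gives 25, and the lower bound \<open>1/4\<close> at the centre gives 4; 104 in place of 100
      makes the estimate strict.\<close>
    define M where "M = 104 * C * (1 + norm s) ^ 2"
    have "104 * 1 * 1 \<le> M" unfolding M_def using C(1) by (intro mult_mono one_le_power) auto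
    then have M: "M > 1" by simp
    have "norm (1 / zeta_reg s) \<le> 4 * M ^ q"
    proof (cases "Re s \<ge> 2")
      case True
      have "norm (zeta_reg s) > 0" using lower[OF True] by linarith
      then have "norm (1 / zeta_reg s) \<le> 4" using lower[OF True] by (simp add: norm_divide divide_le_eq)
      also have "\<dots> \<le> 4 * M ^ q" using one_le_power[of M q] M by simp
      finally show ?thesis .
    next
      case False
      define c where "c = Complex 2 (Im s)"
      have ball: "Re z > \<sigma>0" if "z \<in> ball c R" for z
        using that abs_Re_le_cmod[of "c - z"] by (auto simp: dist_norm c_def R_def)
      have "zeta_reg holomorphic_on ball c R"
        using holomorphic_zeta_reg by (rule holomorphic_on_subset) (use ball \<sigma>0 in force)
      then obtain L0 where L0: "L0 holomorphic_on ball c R" "\<And>z. z \<in> ball c R \<Longrightarrow> zeta_reg z = exp (L0 z)"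
        using contractible_imp_holomorphic_log[OF _ convex_imp_contractible[OF convex_ball], of zeta_reg c R] nz ball
        by metis
      define L where "L z = L0 z - L0 c" for z
      have cR: "c \<in> ball c R" using R by simp
      have gL: "norm (zeta_reg z) = norm (zeta_reg c) * exp (Re (L z))" if "z \<in> ball c R" for z
        using L0(2)[OF that] L0(2)[OF cR] by (simp add: L_def exp_diff)
      have gc: "norm (zeta_reg c) \<ge> 1/4" by (rule lower) (simp add: c_def)
      have "norm (c - s) = 2 - Re s"
        using False by (simp add: c_def cmod_def)
      then have sc: "norm (s - c) \<le> \<theta> * R" using s R by (simp add: \<theta>_def norm_minus_commute)
      also have "\<theta> * R < 1 * R" using \<theta> R by (intro mult_strict_right_mono)
      finally have sR: "s \<in> ball c R" by (simp add: dist_norm norm_minus_commute)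
      have "norm (L s) \<le> 2 * \<theta> / (1 - \<theta>) * ln M"
      proof (rule borel_caratheodory[OF _ _ _ \<theta>(2) sR sc])
        show "L holomorphic_on ball c R" unfolding L_def by (intro holomorphic_intros L0)
        show "L c = 0" by (simp add: L_def)
        fix z assume z: "z \<in> ball c R"
        have "norm z \<le> norm (z - c) + norm (c - s) + norm s"
          using norm_triangle_ineq[of "z - c" "c - s + s"] norm_triangle_ineq[of "c - s" s] by simp
        also have "norm (z - c) \<le> 2" using z R by (simp add: dist_norm norm_minus_commute)
        also have "norm (c - s) \<le> 2" using sR R by (simp add: dist_norm)
        finally have "norm z \<le> 2 + 2 + norm s" by simp
        then have "1 + norm z \<le> 5 * (1 + norm s)" using norm_ge_zero[of s] unfolding distrib_left by linarith
        then have "(1 + norm z)\<^sup>2 \<le> (5 * (1 + norm s))\<^sup>2" by (intro power_mono) auto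
        then have "C * (1 + norm z)\<^sup>2 \<le> C * (5 * (1 + norm s))\<^sup>2" using C(1) by (intro mult_left_mono) auto
        moreover have "norm (zeta_reg z) \<le> C * (1 + norm z) ^ 2"
          using ball[OF z] \<sigma>0 by (intro C(2)) auto
        ultimately have "norm (zeta_reg z) \<le> 25 * C * (1 + norm s)\<^sup>2"
          unfolding power_mult_distrib by simp
        moreover have "1/4 * exp (Re (L z)) \<le> norm (zeta_reg z)"
          unfolding gL[OF z] using gc by (intro mult_right_mono) auto
        moreover have "C * (1 + norm s)\<^sup>2 > 0" using C(1) by (intro mult_pos_pos zero_less_power add_pos_nonneg) auto
        ultimately have "exp (Re (L z)) < M" unfolding M_def by linarith
        then show "Re (L z) < ln M" using M by (metis exp_ln exp_less_cancel_iff less_trans zero_less_one)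
      qed
      also have "\<dots> \<le> real q * ln M" using q M by (intro mult_right_mono) auto
      finally have "- (real q * ln M) \<le> Re (L s)" using abs_Re_le_cmod[of "L s"] by linarith
      then have "exp (- (real q * ln M)) \<le> exp (Re (L s))" by simp
      also have "exp (- (real q * ln M)) = 1 / M ^ q"
        using M by (simp add: exp_minus exp_of_nat_mult inverse_eq_divide)
      finally have "1/4 * (1 / M ^ q) \<le> norm (zeta_reg c) * exp (Re (L s))"
        using gc M by (intro mult_mono) auto
      then have "1 / (4 * M ^ q) \<le> norm (zeta_reg s)" by (simp add: gL[OF sR])
      moreover have "M ^ q > 0" using M by simp
      moreover have "norm (zeta_reg s) > 0" using nz[of s] s \<sigma>0 by simp
      ultimately show ?thesis by (simp add: norm_divide field_simps)
    qed
    then show ?thesis by (simp add: M_def power_mult_distrib power_mult)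
  qed
  then show ?thesis by blast
qed

text \<open>The centre \<open>\<sigma> + X\<close> is left free: \<open>X = 1 - \<sigma>\<close>
  gives the kernel of the theorem, and large \<open>X\<close> controls the tails.\<close>

lemma zeta_log_integrable:
  assumes \<sigma>: "1/2 \<le> \<sigma>" and X: "X > 0" and nz: "zeta_reg (of_real (\<sigma> + X)) \<noteq> 0"
  shows "(\<lambda>t. ln (norm (zeta_reg (Complex \<sigma> t))) / (X\<^sup>2 + t\<^sup>2)) absolutely_integrable_on UNIV"
    and "pi / X * ln (norm (zeta_reg (of_real (\<sigma> + X)))) \<le> integral UNIV (\<lambda>t. ln (norm (zeta_reg (Complex \<sigma> t))) / (X\<^sup>2 + t\<^sup>2))"
proof -
  obtain C where C: "C \<ge> 1" "\<And>s. Re s \<ge> 1/2 \<Longrightarrow> norm (zeta_reg s) \<le> C * (1 + norm s) ^ 2"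
    using zeta_reg_bound by auto
  have "norm (zeta_reg s) \<le> C * (1 + norm s) ^ 2" if "Re s \<ge> \<sigma>" for s using that \<sigma> by (intro C(2)) auto
  from jensen_inequality_half_plane[OF holomorphic_zeta_reg _ X this nz] \<sigma>
  show "(\<lambda>t. ln (norm (zeta_reg (Complex \<sigma> t))) / (X\<^sup>2 + t\<^sup>2)) absolutely_integrable_on UNIV"
    and "pi / X * ln (norm (zeta_reg (of_real (\<sigma> + X)))) \<le> integral UNIV (\<lambda>t. ln (norm (zeta_reg (Complex \<sigma> t))) / (X\<^sup>2 + t\<^sup>2))"
    by auto
qed

text \<open>Strictly inside the zero-free half-plane \<open>1 / zeta_reg\<close> is holomorphic
  across the line and grows polynomially, so Jensen's inequality holds for both functions. Their
  logarithms at the centre 1 vanish, and the two inequalities are opposite.\<close>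

lemma zeta_log_integral_interior:
  assumes \<sigma>: "1/2 \<le> \<sigma>0" "\<sigma>0 < \<sigma>" "\<sigma> < 1" and nz: "\<And>s. Re s > \<sigma>0 \<Longrightarrow> zeta_reg s \<noteq> 0"
  shows "integral UNIV (\<lambda>t. ln (norm (zeta_reg (Complex \<sigma> t))) / ((1 - \<sigma>)\<^sup>2 + t\<^sup>2)) = 0"
proof (rule antisym)
  show "integral UNIV (\<lambda>t. ln (norm (zeta_reg (Complex \<sigma> t))) / ((1 - \<sigma>)\<^sup>2 + t\<^sup>2)) \<ge> 0"
    using zeta_log_integrable(2)[of \<sigma> "1 - \<sigma>"] \<sigma> by (simp add: zeta_reg_1)
  obtain C K where CK: "\<And>s. Re s \<ge> \<sigma> \<Longrightarrow> norm (1 / zeta_reg s) \<le> C * (1 + norm s) ^ K"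
    using inverse_zeta_growth[of \<sigma>0 \<sigma>] \<sigma> nz by auto
  have "(\<lambda>s. 1 / zeta_reg s) holomorphic_on {s. Re s > \<sigma>0}"
    using \<sigma> nz by (intro holomorphic_intros holomorphic_on_subset[OF holomorphic_zeta_reg]) auto
  from jensen_inequality_half_plane(2)[OF this \<sigma>(2) _ CK, of "1 - \<sigma>"] \<sigma>
  have "0 \<le> integral UNIV (\<lambda>t. ln (norm (1 / zeta_reg (Complex \<sigma> t))) / ((1 - \<sigma>)\<^sup>2 + t\<^sup>2))"
    by (simp add: zeta_reg_1)
  also have "(\<lambda>t. ln (norm (1 / zeta_reg (Complex \<sigma> t))) / ((1 - \<sigma>)\<^sup>2 + t\<^sup>2)) =
      (\<lambda>t. - (ln (norm (zeta_reg (Complex \<sigma> t))) / ((1 - \<sigma>)\<^sup>2 + t\<^sup>2)))"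
    using nz \<sigma> by (auto simp: norm_divide ln_div)
  finally show "integral UNIV (\<lambda>t. ln (norm (zeta_reg (Complex \<sigma> t))) / ((1 - \<sigma>)\<^sup>2 + t\<^sup>2)) \<le> 0"
    by simp
qed

section \<open>Passage to the boundary line\<close>

text \<open>The tails are controlled uniformly in \<open>\<sigma>\<close> by applying Jensen's inequality at the far centre
  \<open>\<sigma> + X\<close>, where \<open>ln |(s - 1) \<zeta>(s)| \<ge> 0\<close>: its kernel is comparable to \<open>1 / t\<^sup>2\<close> for \<open>|t| \<ge> X\<close>.\<close>
lemma zeta_log_tail:
  "\<exists>\<delta> :: nat \<Rightarrow> real. \<delta> \<longlonglongrightarrow> 0 \<and> (\<forall>\<sigma> n. 1/2 \<le> \<sigma> \<longrightarrow> \<sigma> < 1 \<longrightarrow>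
      \<bar>integral UNIV (\<lambda>t. ln (norm (zeta_reg (Complex \<sigma> t))) / ((1 - \<sigma>)\<^sup>2 + t\<^sup>2))
       - integral {- (real n + 5)..real n + 5} (\<lambda>t. ln (norm (zeta_reg (Complex \<sigma> t))) / ((1 - \<sigma>)\<^sup>2 + t\<^sup>2))\<bar> \<le> \<delta> n)"
proof -
  obtain C where C: "C \<ge> 1" "\<And>s. Re s \<ge> 1/2 \<Longrightarrow> norm (zeta_reg s) \<le> C * (1 + norm s) ^ 2"
    using zeta_reg_bound by auto
  define D where "D t = ln C + real 2 * ln (2 + 2 * \<bar>t\<bar>)" for t
  have D0: "D t \<ge> 0" for t unfolding D_def using C(1) by (intro add_nonneg_nonneg mult_nonneg_nonneg ln_ge_zero) auto
  have Dint: "(\<lambda>t. D t / (X\<^sup>2 + t\<^sup>2)) absolutely_integrable_on UNIV" if "X > 0" for X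
    unfolding D_def by (rule absolutely_integrable_log_growth[OF that]) simp
  define \<epsilon> where "\<epsilon> n = integral UNIV (\<lambda>t. D t / ((real n + 5)\<^sup>2 + t\<^sup>2))" for n
  have "\<epsilon> \<longlonglongrightarrow> integral UNIV (\<lambda>t::real. 0)"
    unfolding \<epsilon>_def
  proof (rule dominated_convergence(2))
    show "(\<lambda>t. D t / ((real n + 5)\<^sup>2 + t\<^sup>2)) integrable_on UNIV" for n
      using Dint[of "real n + 5"] by (simp add: absolutely_integrable_on_def)
    show "(\<lambda>t. D t / (1\<^sup>2 + t\<^sup>2)) integrable_on UNIV"
      using Dint[of 1] by (simp only: absolutely_integrable_on_def zero_less_one)
    show "norm (D t / ((real n + 5)\<^sup>2 + t\<^sup>2)) \<le> D t / (1\<^sup>2 + t\<^sup>2)" for n t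
    proof -
      have "(1::real)\<^sup>2 \<le> (real n + 5)\<^sup>2" by (intro power_mono) auto
      then show ?thesis using D0[of t] by (auto intro!: divide_left_mono simp: add_pos_nonneg)
    qed
    show "(\<lambda>n. D t / ((real n + 5)\<^sup>2 + t\<^sup>2)) \<longlonglongrightarrow> 0" for t
    proof (rule tendsto_divide_0[OF tendsto_const filterlim_at_top_imp_at_infinity])
      show "filterlim (\<lambda>n. (real n + 5)\<^sup>2 + t\<^sup>2) at_top sequentially" by real_asymp
    qed
  qed
  then have \<epsilon>: "(\<lambda>n. 4 * \<epsilon> n) \<longlonglongrightarrow> 0" using tendsto_mult_right_zero[of \<epsilon> sequentially 4] by simp
  show ?thesis
  proof (intro exI[of _ "\<lambda>n. 4 * \<epsilon> n"] conjI \<epsilon> allI impI)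
    fix \<sigma> :: real and n assume \<sigma>: "1/2 \<le> \<sigma>" "\<sigma> < 1"
    \<comment> \<open>The offset 5 ensures \<open>(\<sigma> + X - 1) / 4 \<ge> 1\<close>, so the
      lower bound on \<open>zeta_reg\<close> makes its logarithm nonnegative at the centre.\<close>
    define X where "X = real n + 5"
    have X: "X \<ge> 5" by (simp add: X_def)
    define l where "l t = ln (norm (zeta_reg (Complex \<sigma> t)))" for t
    have lD: "l t \<le> D t" for t
    proof (cases "zeta_reg (Complex \<sigma> t) = 0")
      \<comment> \<open>At a zero \<open>l t = 0\<close>, because \<open>ln 0 = 0\<close>.\<close>
      case True then show ?thesis using D0 by (simp add: l_def)
    next
      case False
      have "norm (Complex \<sigma> t) \<le> 1 + \<bar>t\<bar>" using cmod_le[of "Complex \<sigma> t"] \<sigma> by simp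
      then have "C * (1 + norm (Complex \<sigma> t)) ^ 2 \<le> C * (2 + 2 * \<bar>t\<bar>) ^ 2"
        using C(1) by (intro mult_left_mono power_mono) auto
      moreover have "norm (zeta_reg (Complex \<sigma> t)) \<le> C * (1 + norm (Complex \<sigma> t)) ^ 2"
        using \<sigma> by (intro C(2)) auto
      ultimately have "l t \<le> ln (C * (2 + 2 * \<bar>t\<bar>) ^ 2)"
        unfolding l_def using False by (intro ln_mono) auto
      also have "\<dots> = D t" unfolding D_def using C(1) by (subst ln_mult) (auto simp: ln_realpow)
      finally show ?thesis .
    qed
    \<comment> \<open>This turns one-sided information into control of the absolute value: the
      integral of \<open>- l\<close> against the far kernel is at most 0, so only that of
      \<open>2 * D\<close> remains.\<close>
    have absl: "\<bar>l t\<bar> \<le> 2 * D t - l t" for t using lD[of t] D0[of t] by linarith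
    have ge1: "norm (zeta_reg (of_real (\<sigma> + X))) \<ge> 1"
    proof -
      have "of_real (\<sigma> + X) - 1 = (of_real (\<sigma> + X - 1) :: complex)" by simp
      then have "norm (of_real (\<sigma> + X) - 1 :: complex) = \<sigma> + X - 1"
        using X \<sigma> by (simp only: norm_of_real)
      then show ?thesis using zeta_reg_lower_bound[of "of_real (\<sigma> + X)"] X \<sigma> by simp
    qed
    then have nz: "zeta_reg (of_real (\<sigma> + X)) \<noteq> 0" by auto
    have lX: "(\<lambda>t. l t / (X\<^sup>2 + t\<^sup>2)) absolutely_integrable_on UNIV"
      "0 \<le> integral UNIV (\<lambda>t. l t / (X\<^sup>2 + t\<^sup>2))"
    proof -
      show "(\<lambda>t. l t / (X\<^sup>2 + t\<^sup>2)) absolutely_integrable_on UNIV"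
        unfolding l_def by (rule zeta_log_integrable(1)[OF \<sigma>(1) _ nz]) (use X in simp)
      have "0 \<le> pi / X * ln (norm (zeta_reg (of_real (\<sigma> + X))))"
        using ge1 X by (intro mult_nonneg_nonneg ln_ge_zero) auto
      also have "\<dots> \<le> integral UNIV (\<lambda>t. l t / (X\<^sup>2 + t\<^sup>2))"
        unfolding l_def by (rule zeta_log_integrable(2)[OF \<sigma>(1) _ nz]) (use X in simp)
      finally show "0 \<le> integral UNIV (\<lambda>t. l t / (X\<^sup>2 + t\<^sup>2))" .
    qed
    define f where "f t = l t / ((1 - \<sigma>)\<^sup>2 + t\<^sup>2)" for t
    have f: "f absolutely_integrable_on UNIV"
      unfolding f_def l_def by (rule zeta_log_integrable(1)) (use \<sigma> zeta_reg_1 in auto)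
    define u where "u t = f t - (if t \<in> {-X..X} then f t else 0)" for t
    have fr: "(\<lambda>t. if t \<in> {-X..X} then f t else 0) integrable_on UNIV"
      using set_integrable_subset[OF f, of "{-X..X}"]
      unfolding integrable_restrict_UNIV absolutely_integrable_on_def by simp
    have fi: "f integrable_on UNIV" using f by (simp add: absolutely_integrable_on_def)
    have u: "u integrable_on UNIV" "integral UNIV u = integral UNIV f - integral {-X..X} f"
      using integrable_diff[OF fi fr] integral_diff[OF fi fr]
      unfolding u_def Henstock_Kurzweil_Integration.integral_restrict_UNIV by (simp_all only:)
    have di: "(\<lambda>t. 4 * (D t / (X\<^sup>2 + t\<^sup>2)) - 2 * (l t / (X\<^sup>2 + t\<^sup>2))) integrable_on UNIV"
      using Dint[of X] lX X
      by (intro integrable_diff integrable_on_mult_right) (auto simp: absolutely_integrable_on_def)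
    have "norm (integral UNIV u) \<le> integral UNIV (\<lambda>t. 4 * (D t / (X\<^sup>2 + t\<^sup>2)) - 2 * (l t / (X\<^sup>2 + t\<^sup>2)))"
    proof (rule integral_norm_bound_integral[OF u(1) di])
      fix t
      have pos: "X\<^sup>2 + t\<^sup>2 > 0" using X by (simp add: add_pos_nonneg)
      have "norm (u t) \<le> 2 * (\<bar>l t\<bar> / (X\<^sup>2 + t\<^sup>2))"
      proof (cases "t \<in> {-X..X}")
        case True then show ?thesis using pos by (simp add: u_def)
      next
        case False
        then have "\<bar>X\<bar> \<le> \<bar>t\<bar>" using X by auto
        then have "X\<^sup>2 \<le> t\<^sup>2" by (simp add: abs_le_square_iff)
        then have "X\<^sup>2 + t\<^sup>2 \<le> 2 * ((1 - \<sigma>)\<^sup>2 + t\<^sup>2)"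
          using zero_le_power2[of "1 - \<sigma>"] unfolding distrib_left by linarith
        then have "2 * \<bar>l t\<bar> / (2 * ((1 - \<sigma>)\<^sup>2 + t\<^sup>2)) \<le> 2 * \<bar>l t\<bar> / (X\<^sup>2 + t\<^sup>2)"
          using pos by (intro divide_left_mono) auto
        then have "\<bar>l t\<bar> / ((1 - \<sigma>)\<^sup>2 + t\<^sup>2) \<le> 2 * \<bar>l t\<bar> / (X\<^sup>2 + t\<^sup>2)"
          by (simp only: mult_divide_mult_cancel_left_if) simp
        then show ?thesis using False by (auto simp: u_def f_def abs_divide)
      qed
      also have "\<dots> \<le> 2 * ((2 * D t - l t) / (X\<^sup>2 + t\<^sup>2))"
        using absl[of t] pos by (intro mult_left_mono divide_right_mono) auto
      also have "\<dots> = 4 * (D t / (X\<^sup>2 + t\<^sup>2)) - 2 * (l t / (X\<^sup>2 + t\<^sup>2))"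
        by (simp add: diff_divide_distrib)
      finally show "norm (u t) \<le> 4 * (D t / (X\<^sup>2 + t\<^sup>2)) - 2 * (l t / (X\<^sup>2 + t\<^sup>2))" .
    qed
    also have "\<dots> = 4 * \<epsilon> n - 2 * integral UNIV (\<lambda>t. l t / (X\<^sup>2 + t\<^sup>2))"
    proof -
      have "(\<lambda>t. 4 * (D t / (X\<^sup>2 + t\<^sup>2))) integrable_on UNIV" "(\<lambda>t. 2 * (l t / (X\<^sup>2 + t\<^sup>2))) integrable_on UNIV"
        using Dint[of X] lX(1) X unfolding absolutely_integrable_on_def
        by (intro integrable_on_mult_right; simp)+
      then show ?thesis by (simp only: integral_diff integral_mult_right \<epsilon>_def X_def)
    qed
    finally have "norm (integral UNIV u) \<le> 4 * \<epsilon> n" using lX(2) by simp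
    then show "\<bar>integral UNIV (\<lambda>t. ln (norm (zeta_reg (Complex \<sigma> t))) / ((1 - \<sigma>)\<^sup>2 + t\<^sup>2))
       - integral {- (real n + 5)..real n + 5} (\<lambda>t. ln (norm (zeta_reg (Complex \<sigma> t))) / ((1 - \<sigma>)\<^sup>2 + t\<^sup>2))\<bar> \<le> 4 * \<epsilon> n"
      using u(2) by (simp add: f_def[abs_def] l_def X_def)
  qed
qed

text \<open>Jensen's inequality on the half-plane is applied to a polynomial whose zeros all lie on
  the boundary line; the integrability it provides is that of the logarithmic singularities.\<close>

lemma ln_abs_poly_integrable:
  assumes "finite Z"
  shows "(\<lambda>t. \<bar>ln \<bar>\<Prod>w\<in>Z. (t - a w) ^ n w\<bar>\<bar> / (1 + t\<^sup>2)) integrable_on (UNIV :: real set)"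
proof -
  define G where "G s = (\<Prod>w\<in>Z. (s - \<i> * of_real (a w)) ^ n w)" for s
  define C where "C = (\<Prod>w\<in>Z. (1 + \<bar>a w\<bar>) ^ n w)"
  have "norm (G s) \<le> C * (1 + norm s) ^ (\<Sum>w\<in>Z. n w)" for s
  proof -
    have "norm (G s) = (\<Prod>w\<in>Z. norm (s - \<i> * of_real (a w)) ^ n w)"
      unfolding G_def by (simp add: prod_norm[symmetric] norm_power)
    also have "\<dots> \<le> (\<Prod>w\<in>Z. ((1 + \<bar>a w\<bar>) * (1 + norm s)) ^ n w)"
    proof (intro prod_mono conjI power_mono zero_le_power norm_ge_zero)
      fix w
      have "norm (s - \<i> * of_real (a w)) \<le> norm s + \<bar>a w\<bar>"
        using norm_triangle_ineq4[of s "\<i> * of_real (a w)"] by (simp add: norm_mult)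
      also have "\<dots> \<le> (1 + \<bar>a w\<bar>) * (1 + norm s)" by (simp add: algebra_simps)
      finally show "norm (s - \<i> * of_real (a w)) \<le> (1 + \<bar>a w\<bar>) * (1 + norm s)" .
    qed
    also have "\<dots> = C * (1 + norm s) ^ (\<Sum>w\<in>Z. n w)"
      unfolding C_def by (simp add: power_mult_distrib prod.distrib power_sum)
    finally show ?thesis .
  qed
  moreover have "G holomorphic_on {s. Re s > -1}" unfolding G_def by (intro holomorphic_intros)
  moreover have "G (of_real (0 + 1)) \<noteq> 0" 
  proof -
    have "1 - \<i> * of_real (a w) \<noteq> 0" for w by (simp add: complex_eq_iff)
    then show ?thesis using assms by (simp add: G_def)
  qed
  ultimately have "(\<lambda>t. ln (norm (G (Complex 0 t))) / (1\<^sup>2 + t\<^sup>2)) absolutely_integrable_on UNIV"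
    by (intro jensen_inequality_half_plane(1)[where \<sigma>' = "-1"]) auto
  then have "(\<lambda>t. norm (ln (norm (G (Complex 0 t))) / (1\<^sup>2 + t\<^sup>2))) integrable_on UNIV"
    by (simp add: absolutely_integrable_on_def)
  moreover have "norm (G (Complex 0 t)) = \<bar>\<Prod>w\<in>Z. (t - a w) ^ n w\<bar>" for t
  proof -
    have "Complex 0 t - \<i> * of_real (a w) = \<i> * of_real (t - a w)" for w by (simp add: complex_eq_iff)
    then have "norm (Complex 0 t - \<i> * of_real (a w)) = \<bar>t - a w\<bar>" for w
      by (simp only: norm_mult norm_of_real norm_ii mult_1)
    then show ?thesis
      unfolding G_def by (simp add: prod_norm[symmetric] norm_power abs_prod power_abs)
  qed
  moreover have "\<bar>1\<^sup>2 + t\<^sup>2\<bar> = 1 + t\<^sup>2" for t :: real by (simp add: add_nonneg_nonneg)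
  ultimately show ?thesis by (simp add: abs_divide)
qed

text \<open>Zeros in the rectangle \<open>K\<close> rule out a bounded majorant. Since
  \<open>norm (z - w) \<ge> |t - Im w|\<close> for each zero \<open>w\<close>,
  \<open>|zeta_reg|\<close> is at least a constant times a real polynomial in \<open>t\<close>
  alone, the same for all lines, and its logarithm is integrable.\<close>

lemma zeta_log_integral_local_limit:
  assumes \<sigma>: "1/2 \<le> \<sigma>0" "\<sigma>0 < \<sigma>2" "\<sigma>2 < 1"
    and s: "\<And>k. \<sigma>0 \<le> s k" "\<And>k. s k \<le> \<sigma>2" "s \<longlonglongrightarrow> \<sigma>0"
  shows "(\<lambda>k. integral {-X..X} (\<lambda>t. ln (norm (zeta_reg (Complex (s k) t))) / ((1 - s k)\<^sup>2 + t\<^sup>2)))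
    \<longlonglongrightarrow> integral {-X..X} (\<lambda>t. ln (norm (zeta_reg (Complex \<sigma>0 t))) / ((1 - \<sigma>0)\<^sup>2 + t\<^sup>2))"
proof -
  define K where "K = cbox (Complex \<sigma>0 (-X)) (Complex \<sigma>2 X)"
  have K: "Complex \<sigma> t \<in> K" if "\<sigma>0 \<le> \<sigma>" "\<sigma> \<le> \<sigma>2" "t \<in> {-X..X}" for \<sigma> t
    using that by (auto simp: K_def in_cbox_complex_iff)
  have cK: "compact K" unfolding K_def by (rule compact_cbox)
  have subK: "K \<subseteq> {s. Re s > 0}" using \<sigma> by (auto simp: K_def in_cbox_complex_iff)
  obtain Z n h where Z: "finite Z" and h: "h holomorphic_on {s. Re s > 0}" "\<forall>z\<in>K. h z \<noteq> 0"
    and gh: "\<forall>z\<in>{s. Re s > 0}. zeta_reg z = h z * (\<Prod>w\<in>Z. (z - w) ^ n w)"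
    using holomorphic_factor_compact[OF holomorphic_zeta_reg open_Re_gt connected_Re_gt cK subK, of 1] zeta_reg_1
    by auto
  define P where "P t = (\<Prod>w\<in>Z. (t - Im w) ^ n w)" for t :: real
  have "continuous_on K (\<lambda>z. 1 / h z)"
    using h subK by (intro continuous_intros holomorphic_on_imp_continuous_on) (auto intro: holomorphic_on_subset)
  then have "bounded ((\<lambda>z. 1 / h z) ` K)" by (intro compact_imp_bounded compact_continuous_image cK)
  then obtain B where B: "B > 0" "\<And>z. z \<in> K \<Longrightarrow> norm (1 / h z) \<le> B" unfolding bounded_pos by blast
  have "continuous_on K zeta_reg"
    using holomorphic_zeta_reg subK by (intro holomorphic_on_imp_continuous_on) (auto intro: holomorphic_on_subset)
  then have "bounded (zeta_reg ` K)" by (intro compact_imp_bounded compact_continuous_image cK)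
  then obtain M where M: "M > 0" "\<And>z. z \<in> K \<Longrightarrow> norm (zeta_reg z) \<le> M" unfolding bounded_pos by blast
  have lower: "\<bar>P t\<bar> / B \<le> norm (zeta_reg (Complex \<sigma> t))" if \<sigma>t: "\<sigma>0 \<le> \<sigma>" "\<sigma> \<le> \<sigma>2" "t \<in> {-X..X}" for \<sigma> t
  proof -
    define z where "z = Complex \<sigma> t"
    have z: "z \<in> K" unfolding z_def by (rule K[OF \<sigma>t])
    have "\<bar>P t\<bar> \<le> (\<Prod>w\<in>Z. norm (z - w) ^ n w)"
      unfolding P_def abs_prod power_abs
    proof (intro prod_mono conjI power_mono zero_le_power abs_ge_zero)
      show "\<bar>t - Im w\<bar> \<le> norm (z - w)" for w using abs_Im_le_cmod[of "z - w"] by (simp add: z_def)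
    qed
    moreover have "1 / B \<le> norm (h z)"
    proof -
      have "norm (h z) > 0" using h(2) z by simp
      then show ?thesis using B(1) B(2)[OF z] by (simp add: norm_divide field_simps)
    qed
    ultimately have "1 / B * \<bar>P t\<bar> \<le> norm (h z) * (\<Prod>w\<in>Z. norm (z - w) ^ n w)"
      by (intro mult_mono) auto
    then show ?thesis using gh z subK by (auto simp: z_def norm_mult prod_norm[symmetric] norm_power subset_eq)
  qed
  define E where "E = {t. P t = 0}"
  have "E \<subseteq> Im ` Z" using Z by (auto simp: E_def P_def prod_zero_iff)
  then have E: "negligible E" using Z by (meson finite_imageI finite_subset negligible_finite)
  \<comment> \<open>Removes the zeros of \<open>P\<close>: there \<open>ln \<bar>P t\<bar>\<close>
    has the default value 0 and dominates nothing, and the integrand may fail to converge.\<close>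
  define S where "S = {-X..X} - E"
  have int_S: "integral S f = integral {-X..X} f" for f :: "real \<Rightarrow> real"
    by (rule integral_subset_negligible) (auto simp: S_def intro: negligible_subset[OF E])
  have integrable_S: "f integrable_on S" if "f integrable_on UNIV" for f :: "real \<Rightarrow> real"
  proof -
    have "f integrable_on {-X..X}" using that integrable_on_subinterval by blast
    then show ?thesis
      by (rule integrable_spike_set) (auto simp: S_def intro: negligible_subset[OF E])
  qed
  define c where "c = (1 - \<sigma>2)\<^sup>2"
  have c: "c > 0" using \<sigma> by (simp add: c_def)
  define H where "H t = (\<bar>ln B\<bar> + \<bar>ln M\<bar> + (1 + X\<^sup>2) * (\<bar>ln \<bar>P t\<bar>\<bar> / (1 + t\<^sup>2))) / c" for t
  define f where "f \<sigma> t = ln (norm (zeta_reg (Complex \<sigma> t))) / ((1 - \<sigma>)\<^sup>2 + t\<^sup>2)" for \<sigma> t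
  have "(\<lambda>k. integral S (f (s k))) \<longlonglongrightarrow> integral S (f \<sigma>0)"
  proof (rule dominated_convergence(2))
    show "f (s k) integrable_on S" for k
    proof (rule integrable_S)
      have "f (s k) absolutely_integrable_on UNIV"
        unfolding f_def by (rule zeta_log_integrable(1)) (use \<sigma> s(1,2)[of k] zeta_reg_1 in auto)
      then show "f (s k) integrable_on UNIV" by (simp add: absolutely_integrable_on_def)
    qed
    have "(\<lambda>t. (1 + X\<^sup>2) * (\<bar>ln \<bar>P t\<bar>\<bar> / (1 + t\<^sup>2))) integrable_on S"
      unfolding P_def by (intro integrable_on_mult_right integrable_S ln_abs_poly_integrable Z)
    moreover have "(\<lambda>t. \<bar>ln B\<bar> + \<bar>ln M\<bar>) integrable_on S"
      by (rule integrable_spike_set[OF integrable_const_ivl[of _ "-X" X]])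
        (auto simp: S_def intro: negligible_subset[OF E])
    ultimately show "H integrable_on S"
      unfolding H_def by (intro integrable_on_divide) (rule integrable_add)
    show "norm (f (s k) t) \<le> H t" if t: "t \<in> S" for k t
    proof -
      have tX: "t \<in> {-X..X}" and Pt: "\<bar>P t\<bar> > 0" using t by (auto simp: S_def E_def)
      define y where "y = norm (zeta_reg (Complex (s k) t))"
      have y1: "\<bar>P t\<bar> / B \<le> y" unfolding y_def by (rule lower[OF s(1,2) tX])
      have y2: "y \<le> M" unfolding y_def by (rule M(2)[OF K[OF s(1,2) tX]])
      have y0: "y > 0" using y1 Pt B(1) by (meson divide_pos_pos less_le_trans)
      have "ln (\<bar>P t\<bar> / B) \<le> ln y" "ln y \<le> ln M" using y1 y2 y0 Pt B(1) by (auto intro!: ln_mono)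
      then have "\<bar>ln y\<bar> \<le> \<bar>ln B\<bar> + \<bar>ln M\<bar> + \<bar>ln \<bar>P t\<bar>\<bar>" using Pt B(1) by (simp add: ln_div)
      also have "\<bar>ln \<bar>P t\<bar>\<bar> \<le> (1 + X\<^sup>2) * (\<bar>ln \<bar>P t\<bar>\<bar> / (1 + t\<^sup>2))"
      proof -
        have "t\<^sup>2 \<le> X\<^sup>2" using tX by (intro abs_le_square_iff[THEN iffD1]) auto
        then have "\<bar>ln \<bar>P t\<bar>\<bar> * (1 + t\<^sup>2) \<le> \<bar>ln \<bar>P t\<bar>\<bar> * (1 + X\<^sup>2)" by (intro mult_left_mono) auto
        moreover have "1 + t\<^sup>2 > 0" by (simp add: add_pos_nonneg)
        ultimately show ?thesis by (simp add: le_divide_eq mult.commute)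
      qed
      finally have num: "\<bar>ln y\<bar> \<le> \<bar>ln B\<bar> + \<bar>ln M\<bar> + (1 + X\<^sup>2) * (\<bar>ln \<bar>P t\<bar>\<bar> / (1 + t\<^sup>2))" by simp
      have "c \<le> (1 - s k)\<^sup>2" unfolding c_def using s(2)[of k] \<sigma> by (intro power_mono) auto
      then have "c \<le> (1 - s k)\<^sup>2 + t\<^sup>2" using zero_le_power2[of t] by linarith
      then have "\<bar>ln y\<bar> / ((1 - s k)\<^sup>2 + t\<^sup>2) \<le> H t"
        unfolding H_def using num c by (intro frac_le) auto
      then show ?thesis by (simp add: f_def y_def abs_divide)
    qed
    show "(\<lambda>k. f (s k) t) \<longlonglongrightarrow> f \<sigma>0 t" if t: "t \<in> S" for t
    proof -
      have tX: "t \<in> {-X..X}" and Pt: "\<bar>P t\<bar> > 0" using t by (auto simp: S_def E_def)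
      have "0 < \<bar>P t\<bar> / B" using Pt B(1) by simp
      also have "\<dots> \<le> norm (zeta_reg (Complex \<sigma>0 t))" by (rule lower) (use \<sigma> tX in auto)
      finally have nz: "norm (zeta_reg (Complex \<sigma>0 t)) \<noteq> 0" by simp
      have "isCont zeta_reg (Complex \<sigma>0 t)"
        using holomorphic_on_imp_continuous_on[OF holomorphic_zeta_reg] open_Re_gt[of 0] \<sigma>
        by (auto simp: continuous_on_eq_continuous_at)
      moreover have "(\<lambda>k. Complex (s k) t) \<longlonglongrightarrow> Complex \<sigma>0 t"
        by (intro tendsto_Complex s(3) tendsto_const)
      ultimately have "(\<lambda>k. zeta_reg (Complex (s k) t)) \<longlonglongrightarrow> zeta_reg (Complex \<sigma>0 t)"
        by (rule isCont_tendsto_compose)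
      moreover have "(1 - \<sigma>0)\<^sup>2 + t\<^sup>2 > 0" using \<sigma> by (intro add_pos_nonneg) auto
      ultimately show ?thesis unfolding f_def using nz by (intro tendsto_intros s(3)) auto
    qed
  qed
  then show ?thesis unfolding int_S f_def .
qed

text \<open>The window is kept fixed while the line moves: the full integrals vanish on the way, so
  the window integrals stay below \<open>\<delta> n\<close>, also in the limit. Only then does the
  window grow. This order is possible because \<open>\<delta>\<close> does not depend on the
  line.\<close>

lemma zeta_log_integral_boundary:
  assumes \<sigma>: "1/2 \<le> \<sigma>0" "\<sigma>0 < 1" and nz: "\<And>s. Re s > \<sigma>0 \<Longrightarrow> zeta_reg s \<noteq> 0"
  shows "integral UNIV (\<lambda>t. ln (norm (zeta_reg (Complex \<sigma>0 t))) / ((1 - \<sigma>0)\<^sup>2 + t\<^sup>2)) = 0"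
proof -
  define I where "I \<sigma> = integral UNIV (\<lambda>t. ln (norm (zeta_reg (Complex \<sigma> t))) / ((1 - \<sigma>)\<^sup>2 + t\<^sup>2))" for \<sigma>
  define J where "J n \<sigma> = integral {- (real n + 5)..real n + 5} (\<lambda>t. ln (norm (zeta_reg (Complex \<sigma> t))) / ((1 - \<sigma>)\<^sup>2 + t\<^sup>2))" for n \<sigma>
  obtain \<delta> where \<delta>: "\<delta> \<longlonglongrightarrow> 0" "\<And>\<sigma> n. \<lbrakk>1/2 \<le> \<sigma>; \<sigma> < 1\<rbrakk> \<Longrightarrow> \<bar>I \<sigma> - J n \<sigma>\<bar> \<le> \<delta> n"
    using zeta_log_tail unfolding I_def J_def by blast
  \<comment> \<open>The \<open>+ 2\<close> keeps every line at or to the left of the midpoint of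
    \<open>\<sigma>0\<close> and 1, so the kernels do not degenerate at
    \<open>t = 0\<close>.\<close>
  define s where "s k = \<sigma>0 + (1 - \<sigma>0) / (real k + 2)" for k
  have s: "\<sigma>0 < s k" "s k \<le> \<sigma>0 + (1 - \<sigma>0) / 2" for k
  proof -
    show "\<sigma>0 < s k" using \<sigma> by (simp add: s_def)
    have "(1 - \<sigma>0) / (real k + 2) \<le> (1 - \<sigma>0) / 2" using \<sigma> by (intro divide_left_mono) auto
    then show "s k \<le> \<sigma>0 + (1 - \<sigma>0) / 2" by (simp only: s_def add_left_mono)
  qed
  have s1: "s k < 1" for k using s(2)[of k] \<sigma> by (simp add: field_simps)
  have slim: "s \<longlonglongrightarrow> \<sigma>0" unfolding s_def by real_asymp
  have "\<bar>I \<sigma>0\<bar> \<le> 2 * \<delta> n" for n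
  proof -
    have "(\<lambda>k. J n (s k)) \<longlonglongrightarrow> J n \<sigma>0"
      unfolding J_def
      by (rule zeta_log_integral_local_limit[of \<sigma>0 "\<sigma>0 + (1 - \<sigma>0) / 2"])
        (use \<sigma> s slim in \<open>auto intro: less_imp_le simp: field_simps\<close>)
    moreover have "\<bar>J n (s k)\<bar> \<le> \<delta> n" for k
    proof -
      have "I (s k) = 0" unfolding I_def
        by (rule zeta_log_integral_interior[OF \<sigma>(1) s(1) s1 nz])
      then show ?thesis using \<delta>(2)[of "s k" n] s(1)[of k] s1[of k] \<sigma> by simp
    qed
    ultimately have "\<bar>J n \<sigma>0\<bar> \<le> \<delta> n"
      by (intro LIMSEQ_le_const2[OF tendsto_rabs]) auto
    then show ?thesis using \<delta>(2)[OF \<sigma>, of n] by linarith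
  qed
  moreover have "(\<lambda>n. 2 * \<delta> n) \<longlonglongrightarrow> 0" using tendsto_mult_right_zero[OF \<delta>(1)] by simp
  ultimately have "\<bar>I \<sigma>0\<bar> \<le> 0"
    by (intro LIMSEQ_le_const[of "\<lambda>n. 2 * \<delta> n"]) auto
  then show ?thesis by (simp add: I_def)
qed

theorem theorem4:
  fixes \<alpha> :: real
  assumes "0 \<le> \<alpha>" and "\<alpha> < 1/2"
  shows "((\<lambda>t::real. ln (cmod (riemann_zeta (Complex (1/2 + \<alpha>) t) * Complex (-1/2 + \<alpha>) t))
                        / ((1/2 - \<alpha>)\<^sup>2 + t\<^sup>2)) has_integral 0) UNIV
         \<longleftrightarrow> (\<forall>s. s \<noteq> 1 \<and> Re s > 1/2 + \<alpha> \<longrightarrow> riemann_zeta s \<noteq> 0)"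
proof -
  define \<sigma> where "\<sigma> = 1/2 + \<alpha>"
  have \<sigma>: "1/2 \<le> \<sigma>" "\<sigma> < 1" using assms by (auto simp: \<sigma>_def)
  have "riemann_zeta (Complex (1/2 + \<alpha>) t) * Complex (-1/2 + \<alpha>) t = zeta_reg (Complex \<sigma> t)" for t
  proof -
    have "Complex (-1/2 + \<alpha>) t = Complex \<sigma> t - 1" by (simp add: complex_eq_iff \<sigma>_def)
    moreover have "Complex \<sigma> t \<noteq> 1" using \<sigma> by (simp add: complex_eq_iff)
    ultimately show ?thesis using zeta_reg_eq[of "Complex \<sigma> t"] \<sigma> by (simp add: \<sigma>_def)
  qed
  moreover have "1/2 - \<alpha> = 1 - \<sigma>" by (simp add: \<sigma>_def)
  ultimately have integrand: "(\<lambda>t. ln (cmod (riemann_zeta (Complex (1/2 + \<alpha>) t) * Complex (-1/2 + \<alpha>) t))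
        / ((1/2 - \<alpha>)\<^sup>2 + t\<^sup>2)) = (\<lambda>t. ln (norm (zeta_reg (Complex \<sigma> t))) / ((1 - \<sigma>)\<^sup>2 + t\<^sup>2))" (is "_ = ?f")
    by (simp only:)
  have zeros: "riemann_zeta s = 0 \<longleftrightarrow> zeta_reg s = 0" if "s \<noteq> 1" "Re s > \<sigma>" for s
    using zeta_reg_eq[of s] that \<sigma> by auto
  \<comment> \<open>\<open>has_integral 0\<close> also asserts existence, whereas
    \<open>integral\<close> takes the default value 0 on functions that are not integrable.\<close>
  have int: "?f integrable_on UNIV"
    using zeta_log_integrable(1)[OF \<sigma>(1), of "1 - \<sigma>"] \<sigma> zeta_reg_1 by (simp add: absolutely_integrable_on_def)
  have "(?f has_integral 0) UNIV \<longleftrightarrow> (\<forall>s. s \<noteq> 1 \<and> Re s > \<sigma> \<longrightarrow> riemann_zeta s \<noteq> 0)"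
  proof
    assume "(?f has_integral 0) UNIV"
    then have "integral UNIV ?f = 0" by (rule integral_unique)
    then have "zeta_reg s \<noteq> 0" if "Re s > \<sigma>" for s
      using zeta_log_integral_pos[OF \<sigma> that] by auto
    then show "\<forall>s. s \<noteq> 1 \<and> Re s > \<sigma> \<longrightarrow> riemann_zeta s \<noteq> 0"
      using zeros by blast
  next
    assume "\<forall>s. s \<noteq> 1 \<and> Re s > \<sigma> \<longrightarrow> riemann_zeta s \<noteq> 0"
    \<comment> \<open>The assumption says nothing about \<open>s = 1\<close>; there
      \<open>zeta_reg\<close> has the value 1.\<close>
    then have "zeta_reg s \<noteq> 0" if "Re s > \<sigma>" for s
      using zeros zeta_reg_1 that by (cases "s = 1") auto
    then have "integral UNIV ?f = 0" by (rule zeta_log_integral_boundary[OF \<sigma>])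
    then show "(?f has_integral 0) UNIV" using integrable_integral[OF int] by simp
  qed
  then show ?thesis unfolding integrand unfolding \<sigma>_def .
qed

end
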